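(* Let $M(\omega)$, $\omega\in\Omega$, be a random reduced dynamics operator on $\mathbb{C}^d$ with probability space $(\Omega,\mathcal{F},\mathrm{p})$, and suppose that $\mathrm{p}(M(\omega)\in\mathcal{M}_{(E)})>0$. Then $\mathbb{E}[M]\in\mathcal{M}_{(E)}$. Moreover, there exists a set $\Omega_2\subset\Omega^{\mathbb{N}^*}$ with $\mathbb{P}(\Omega_2)=1$ such that for all $\overline\omega=(\omega_j)_{j\ge1}\in\Omega_2$, $$\lim_{N\to\infty}\frac1N\sum_{n=1}^N\theta_n(\overline\omega)=\theta,$$ where $$\theta=\left(\mathbf{1}-\mathbb{E}[M_Q]^*\right)^{-1}\mathbb{E}[\psi]=P_{1,\mathbb{E}[M]}^*\,\mathbb{E}[\psi]=P_{1,\mathbb{E}[M]}^*\,\psi_{\mathcal S}.$$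
   Context: Inner products on $\mathbb{C}^d$ are linear in the second factor; $\|\cdot\|$ is the Euclidean norm and the induced operator norm; $|\psi\rangle\langle\phi|$ denotes $\chi\mapsto\langle\phi,\chi\rangle\psi$. $\mathbb{N}^*=\{1,2,\dots\}$. A random reduced dynamics operator (RRDO) is a measurable map $\omega\mapsto M(\omega)\in M_d(\mathbb{C})$ on a probability space $(\Omega,\mathcal{F},\mathrm{p})$ such that: (1) there is a norm $|||\cdot|||$ on $\mathbb{C}^d$ (independent of $\omega$) for which every $M(\omega)$ is a contraction; (2) there is a vector $\psi_{\mathcal S}$, independent of $\omega$, normalized by $\|\psi_{\mathcal S}\|=1$, with $M(\omega)\psi_{\mathcal S}=\psi_{\mathcal S}$ for all $\omega$. $\mathcal{M}_{(E)}$ is the set of matrices $M$ with $|||M|||\le1$ and $M\psi_{\mathcal S}=\psi_{\mathcal S}$ whose spectrum on the complex unit circle consists only of the simple eigenvalue $1$. Let $P_1(\omega)$ be the spectral (Riesz) projection of $M(\omega)$ for the eigenvalue $1$; set $\psi(\omega)=P_1(\omega)^*\psi_{\mathcal S}$, $P(\omega)=|\psi_{\mathcal S}\rangle\langle\psi(\omega)|$ (a projection, as $\langle\psi_{\mathcal S},\psi(\omega)\rangle=1$), $Q(\omega)=\mathbf{1}-P(\omega)$, and $M_Q(\omega)=Q(\omega)M(\omega)Q(\omega)$; one has $M(\omega)=P(\omega)+M_Q(\omega)$. $\mathbb{P}=\prod_{j\ge1}\mathrm{p}$ is the product probability measure on $\Omega^{\mathbb{N}^*}$. For a random variable $f$ on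 $\Omega$, $\mathbb{E}[f]=\int_\Omega f\,d\mathrm{p}$. $P_{1,\mathbb{E}[M]}$ is the spectral projection of $\mathbb{E}[M]$ for the eigenvalue $1$. For $n\ge1$, $$\theta_n(\overline\omega)=M(\omega_n)^*M(\omega_{n-1})^*\cdots M(\omega_2)^*\psi(\omega_1)\qquad(\theta_1(\overline\omega)=\psi(\omega_1)).$$ *)

theory Defs
  imports "HOL-Complex_Analysis.Complex_Analysis" "HOL-Probability.Probability"
begin

definition cinner :: "complex^'n \<Rightarrow> complex^'n \<Rightarrow> complex" where
  "cinner x y = (\<Sum>i\<in>UNIV. cnj (x $ i) * y $ i)"

definition cadjoint :: "complex^'n^'m \<Rightarrow> complex^'m^'n" where
  "cadjoint A = (\<chi> i j. cnj (A $ j $ i))"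

text \<open>The rank-one matrix of \<open>v \<mapsto> \<langle>\<phi>, v\<rangle> \<psi>\<close>.\<close>

definition ketbra :: "complex^'m \<Rightarrow> complex^'n \<Rightarrow> complex^'n^'m" where
  "ketbra \<psi> \<phi> = matrix (\<lambda>v. cinner \<phi> v *s \<psi>)"

definition spectrum :: "complex^'n^'n \<Rightarrow> complex set" where
  "spectrum A = {z. \<not> invertible (mat z - A)}"

definition charpoly :: "complex^'n^'n \<Rightarrow> complex poly" where
  "charpoly A = det (mat [:0, 1:] - (\<chi> i j. [:A $ i $ j:]))"

text \<open>Simple means algebraic multiplicity one.\<close>

definition simple_eigenvalue :: "complex^'n^'n \<Rightarrow> complex \<Rightarrow> bool" where
  "simple_eigenvalue A z \<longleftrightarrow> z \<in> spectrum A \<and> order z (charpoly A) = 1"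

text \<open>
  The integral of the resolvent over a positively oriented circle which encloses no point of
  the spectrum other than \<open>z\<close>, divided by \<open>2 * pi * \<i>\<close>, taken entry by entry. The value does
  not depend on the radius of such a circle.
\<close>

definition riesz_radius :: "complex^'n^'n \<Rightarrow> complex \<Rightarrow> real" where
  "riesz_radius A z = (SOME r. 0 < r \<and> spectrum A \<inter> cball z r \<subseteq> {z})"

definition riesz_projection :: "complex^'n^'n \<Rightarrow> complex \<Rightarrow> complex^'n^'n" where
  "riesz_projection A z =
     (\<chi> i j. contour_integral (circlepath z (riesz_radius A z))
                (\<lambda>\<zeta>. matrix_inv (mat \<zeta> - A) $ i $ j) / (2 * of_real pi * \<i>))"

text \<open>An arbitrary norm on the complex vector space \<open>complex^'n\<close>.\<close>

definition is_norm :: "(complex^'n \<Rightarrow> real) \<Rightarrow> bool" where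
  "is_norm N \<longleftrightarrow>
     (\<forall>v. 0 \<le> N v) \<and> (\<forall>v. N v = 0 \<longleftrightarrow> v = 0) \<and>
     (\<forall>c v. N (c *s v) = cmod c * N v) \<and> (\<forall>v w. N (v + w) \<le> N v + N w)"

text \<open>
  The matrix norm induced by \<open>N\<close>, in the form of \<^const>\<open>onorm\<close>: the vector \<open>v = 0\<close> contributes
  \<open>0 / 0 = 0\<close>, and the supremum is over a bounded set, as all norms are equivalent.
\<close>

definition induced_norm :: "(complex^'n \<Rightarrow> real) \<Rightarrow> complex^'n^'n \<Rightarrow> real" where
  "induced_norm N A = (SUP v. N (A *v v) / N v)"

definition M_E :: "(complex^'n \<Rightarrow> real) \<Rightarrow> complex^'n \<Rightarrow> (complex^'n^'n) set" where
  "M_E N \<psi>S = {A. induced_norm N A \<le> 1 \<and> A *v \<psi>S = \<psi>S \<and>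
                  spectrum A \<inter> sphere 0 1 = {1} \<and> simple_eigenvalue A 1}"

text \<open>Random reduced dynamics operators.\<close>

locale RRDO = prob_space p
  for p :: "'w measure"
    and M :: "'w \<Rightarrow> complex^'n^'n"
    and N :: "complex^'n \<Rightarrow> real"
    and \<psi>S :: "complex^'n" +
  assumes measurable_M: "M \<in> borel_measurable p"
    and norm_N: "is_norm N"
    and contraction: "\<omega> \<in> space p \<Longrightarrow> N (M \<omega> *v v) \<le> N v"
    and normalized: "norm \<psi>S = 1"
    and invariant: "\<omega> \<in> space p \<Longrightarrow> M \<omega> *v \<psi>S = \<psi>S"

definition psi :: "complex^'n \<Rightarrow> complex^'n^'n \<Rightarrow> complex^'n" where
  "psi \<psi>S A = cadjoint (riesz_projection A 1) *v \<psi>S"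

definition P_of :: "complex^'n \<Rightarrow> complex^'n^'n \<Rightarrow> complex^'n^'n" where
  "P_of \<psi>S A = ketbra \<psi>S (psi \<psi>S A)"

definition Q_of :: "complex^'n \<Rightarrow> complex^'n^'n \<Rightarrow> complex^'n^'n" where
  "Q_of \<psi>S A = mat 1 - P_of \<psi>S A"

definition M_Q :: "complex^'n \<Rightarrow> complex^'n^'n \<Rightarrow> complex^'n^'n" where
  "M_Q \<psi>S A = Q_of \<psi>S A ** A ** Q_of \<psi>S A"

text \<open>
  For \<open>n \<ge> 1\<close> the vector \<open>M(\<omega> n)\<^sup>* \<cdots> M(\<omega> 2)\<^sup>* \<psi>(\<omega> 1)\<close>: the fold applies the adjoint with
  index 2 first and the one with index \<open>n\<close> last.
\<close>

definition theta :: "('w \<Rightarrow> complex^'n^'n) \<Rightarrow> complex^'n \<Rightarrow> (nat \<Rightarrow> 'w) \<Rightarrow> nat \<Rightarrow> complex^'n" where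
  "theta M \<psi>S \<omega> n =
     fold (\<lambda>j v. cadjoint (M (\<omega> j)) *v v) [2..<Suc n] (psi \<psi>S (M (\<omega> 1)))"

end

theory Submission
  imports Defs "HOL-Library.Discrete_Functions"
begin

text \<open>
  For a contraction the Riesz projection for 1 is the limit of the Cesaro means of the powers;
  this makes \<open>\<psi>(\<omega>)\<close> bounded and measurable. A left eigenvector of \<open>E[M]\<close> for a unimodular
  eigenvalue which annihilates \<open>\<psi>\<^sub>S\<close> would, by extremality in the dual norm, force such an
  eigenvalue on a matrix of the class \<open>M_E\<close> in the support of the law of \<open>M\<close>. Hence there is
  none, so \<open>E[M]\<close> lies in \<open>M_E\<close>, its Riesz projection has rank one, and \<open>1 - E[M_Q]\<^sup>*\<close> is
  invertible. The differences \<open>\<theta>\<^sub>n\<^sub>+\<^sub>1 - E[M]\<^sup>* \<theta>\<^sub>n\<close> are bounded and pairwise orthogonal, so their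
  averages vanish almost surely. Telescoping and \<open>\<langle>\<psi>\<^sub>S, \<theta>\<^sub>n\<rangle> = 1\<close> turn this into
  \<open>(1 - E[M_Q]\<^sup>*) avg \<longlonglongrightarrow> E[\<psi>]\<close> for the averages of \<open>\<theta>\<^sub>n\<close>.
\<close>

text \<open>Three obstacles shape the proof. The almost sure equality forced by extremality has an
  exceptional null set that depends on the tested vector, while the vectors to be tested are the
  iterates of the very matrix to be picked. A deterministic support point \<open>A\<close> removes
  this circularity: the equality is a closed condition on the matrix, so it holds at
  \<open>A\<close> for every extremal vector, and \<open>A\<close> can then be iterated. Next,
  consecutive \<open>\<theta>\<^sub>n\<close> share all their old factors and need not converge, so
  a law of large numbers for independent variables does not apply to them; only the newest factor is
  independent of the past, and this is where orthogonality comes from. Finally,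
  \<open>1 - E[M]\<^sup>*\<close> is singular, as 1 is an eigenvalue of \<open>E[M]\<close>. The
  rank-one term by which \<open>E[M_Q]\<^sup>*\<close> differs from \<open>E[M]\<^sup>*\<close>
  repairs exactly this defect.\<close>

no_notation fps_nth (infixl "$" 75)

subsection \<open>Complex matrices\<close>

lemma scaleR_eq_vector_smult: "r *\<^sub>R (v :: complex^'n) = complex_of_real r *s v"
  by (auto simp: vec_eq_iff) (simp add: scaleR_conv_of_real)

lemma cinner_add_right: "cinner x (y + z) = cinner x y + cinner x z"
  by (simp add: cinner_def distrib_left sum.distrib)

lemma cinner_add_left: "cinner (x + y) z = cinner x z + cinner y z"
  by (simp add: cinner_def distrib_right sum.distrib)

lemma cinner_diff_right: "cinner x (y - z) = cinner x y - cinner x z"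
  by (simp add: cinner_def right_diff_distrib sum_subtractf)

lemma cinner_diff_left: "cinner (x - y) z = cinner x z - cinner y z"
  by (simp add: cinner_def left_diff_distrib sum_subtractf)

lemma cinner_smult_right: "cinner x (c *s y) = c * cinner x y"
  by (simp add: cinner_def sum_distrib_left algebra_simps)

lemma cinner_smult_left: "cinner (c *s x) y = cnj c * cinner x y"
  by (simp add: cinner_def sum_distrib_left algebra_simps)

lemma cinner_zero_left [simp]: "cinner 0 x = 0"
  and cinner_zero_right [simp]: "cinner x 0 = 0"
  by (simp_all add: cinner_def)

lemma cinner_commute: "cinner x y = cnj (cinner y x)"
  by (simp add: cinner_def mult.commute)

lemma cinner_axis_left [simp]: "cinner (axis i 1) v = v $ i"
proof -
  have "cinner (axis i 1) v = (\<Sum>j\<in>UNIV. if j = i then v $ j else 0)"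
    unfolding cinner_def axis_def by (intro sum.cong) auto
  then show ?thesis by simp
qed

lemma cinner_axis_right [simp]: "cinner v (axis i 1) = cnj (v $ i)"
  by (subst cinner_commute) simp

lemma cinner_self: "cinner x x = of_real ((norm x)\<^sup>2)"
proof -
  have "(norm x)\<^sup>2 = (\<Sum>i\<in>UNIV. (cmod (x $ i))\<^sup>2)"
    by (simp add: norm_vec_def L2_set_def sum_nonneg)
  then show ?thesis
    by (simp add: cinner_def complex_norm_square mult.commute del: of_real_power)
qed

lemma inner_eq_Re_cinner: "x \<bullet> y = Re (cinner x y)"
  by (simp add: inner_vec_def cinner_def inner_complex_def)

lemma cinner_ext: "(\<And>v. cinner x v = cinner y v) \<Longrightarrow> x = y"
  by (metis cinner_axis_right complex_cnj_cnj vec_eq_iff)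

lemma continuous_on_cinner [continuous_intros]:
  "continuous_on S f \<Longrightarrow> continuous_on S g \<Longrightarrow> continuous_on S (\<lambda>x. cinner (f x) (g x))"
  unfolding cinner_def by (intro continuous_intros)

lemma tendsto_cinner [tendsto_intros]:
  "(f \<longlongrightarrow> a) F \<Longrightarrow> (g \<longlongrightarrow> b) F \<Longrightarrow> ((\<lambda>x. cinner (f x) (g x)) \<longlongrightarrow> cinner a b) F"
  unfolding cinner_def by (intro tendsto_intros)

lemma cinner_cadjoint: "cinner (cadjoint A *v x) y = cinner x (A *v y)"
  unfolding cinner_def cadjoint_def matrix_vector_mult_def
  by (simp add: sum_distrib_left sum_distrib_right ac_simps) (rule sum.swap)

lemma cadjoint_diff: "cadjoint (A - B) = cadjoint A - cadjoint B"
  by (simp add: cadjoint_def vec_eq_iff)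

lemma matrix_vector_mult_smult: "A *v (c *s v) = c *s (A *v v)"
  for A :: "complex^'n^'m"
  by (simp add: vec_eq_iff matrix_vector_mult_def sum_distrib_left algebra_simps)

lemma smult_scaleR_matrix_vector_mult: "(r *\<^sub>R A) *v v = r *\<^sub>R (A *v v)"
  for A :: "complex^'n^'m"
  by (simp add: vec_eq_iff matrix_vector_mult_def scaleR_sum_right)

lemma mat_vector_mult: "mat z *v v = z *s v" for v :: "complex^'n"
proof -
  have "(\<Sum>j\<in>UNIV. (if i = j then z else 0) * v $ j) = z * v $ i" for i
    by (simp add: if_distrib[of "\<lambda>x. x * _"] cong: if_cong)
  then show ?thesis by (simp add: vec_eq_iff matrix_vector_mult_def mat_def)
qed

lemma ketbra_vector_mult: "ketbra \<psi> \<phi> *v v = cinner \<phi> v *s \<psi>"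
proof -
  have "cinner \<phi> (axis j 1) = cnj (\<phi> $ j)" for j by simp
  then show ?thesis
    by (simp add: ketbra_def matrix_def vec_eq_iff matrix_vector_mult_def del: cinner_axis_right)
       (simp add: cinner_def sum_distrib_left ac_simps)
qed

lemma cadjoint_ketbra_vector_mult: "cadjoint (ketbra \<psi> \<phi>) *v v = cinner \<psi> v *s \<phi>"
proof (rule cinner_ext)
  fix w show "cinner (cadjoint (ketbra \<psi> \<phi>) *v v) w = cinner (cinner \<psi> v *s \<phi>) w"
    by (simp add: cinner_cadjoint ketbra_vector_mult cinner_smult_right cinner_smult_left)
       (metis cinner_commute mult.commute)
qed

lemma invertible_iff_kernel: "invertible A \<longleftrightarrow> (\<forall>v. A *v v = 0 \<longrightarrow> v = 0)"
  for A :: "complex^'n^'n"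
  by (simp add: invertible_left_inverse matrix_left_invertible_ker)

lemma matrix_inv_vector_mult:
  fixes A :: "complex^'n^'n"
  assumes "invertible A"
  shows "A *v (matrix_inv A *v v) = v" and "matrix_inv A *v (A *v v) = v"
proof -
  have "A ** matrix_inv A = mat 1 \<and> matrix_inv A ** A = mat 1"
    using assms unfolding invertible_def matrix_inv_def by (rule someI_ex)
  then show "A *v (matrix_inv A *v v) = v" and "matrix_inv A *v (A *v v) = v"
    by (simp_all add: matrix_vector_mul_assoc)
qed

lemma mem_spectrum_iff: "z \<in> spectrum A \<longleftrightarrow> (\<exists>v. v \<noteq> 0 \<and> A *v v = z *s v)"
  by (auto simp: spectrum_def invertible_iff_kernel matrix_vector_mult_diff_rdistrib mat_vector_mult) metis

text \<open>A singular square matrix has a singular transpose, with a kernel vector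
  \<open>x\<close>. As \<open>cinner\<close> is conjugate-linear on the left, the functional is
  represented by the entrywise conjugate of \<open>x\<close>.\<close>

lemma mem_spectrum_left_eigenvector:
  assumes "z \<in> spectrum A"
  obtains g where "g \<noteq> 0" "\<And>v. cinner g (A *v v) = z * cinner g v"
proof -
  let ?B = "mat z - A"
  have "\<not> (\<exists>B. ?B ** B = mat 1)"
    using assms by (simp add: spectrum_def invertible_right_inverse)
  then have "\<not> (\<exists>B. B ** transpose ?B = mat 1)"
    by (simp add: left_invertible_transpose)
  then obtain x where x: "x \<noteq> 0" "transpose ?B *v x = 0"
    by (auto simp: matrix_left_invertible_ker)
  define g where "g = (\<chi> i. cnj (x $ i))"
  have "cadjoint ?B *v g = 0"
  proof -
    have "(cadjoint ?B *v g) $ i = cnj ((transpose ?B *v x) $ i)" for i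
      by (simp add: matrix_vector_mult_def cadjoint_def transpose_def g_def)
    then show ?thesis using x(2) by (simp add: vec_eq_iff del: transpose_matrix_vector)
  qed
  then have "cinner g (?B *v v) = 0" for v
    using cinner_cadjoint[of ?B g v] by simp
  then have "cinner g (A *v v) = z * cinner g v" for v
    by (simp add: matrix_vector_mult_diff_rdistrib mat_vector_mult cinner_diff_right cinner_smult_right)
  moreover have "g \<noteq> 0" using x(1) by (auto simp: g_def vec_eq_iff)
  ultimately show thesis using that by blast
qed

subsection \<open>The characteristic polynomial\<close>

lemma poly_det: "poly (det A) z = det (\<chi> i j. poly (A $ i $ j) z)" for A :: "complex poly^'n^'n"
  by (simp add: det_def poly_sum poly_prod poly_mult)

lemma poly_charpoly:
  fixes A :: "complex^'n^'n"
  shows "poly (charpoly A) z = det (mat z - A)"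
proof -
  have "(\<chi> i j. poly ((mat [:0, 1:] - (\<chi> i j. [:A $ i $ j:]) :: complex poly^'n^'n) $ i $ j) z) = mat z - A"
    by (simp add: vec_eq_iff mat_def)
  then show ?thesis by (simp add: charpoly_def poly_det)
qed

lemma mem_spectrum_iff_charpoly: "z \<in> spectrum A \<longleftrightarrow> poly (charpoly A) z = 0"
  by (simp add: spectrum_def poly_charpoly invertible_det_nz)

text \<open>A nonzero constant has order 0. The factor \<open>[:c:]\<close> is kept because the
  characteristic polynomial will be factored only up to a nonzero coordinate of the
  eigenvector.\<close>

lemma order_eq_1_iff:
  assumes "p \<noteq> 0" "p * [:c:] = [:-a, 1:] * r" "c \<noteq> 0"
  shows "order a p = 1 \<longleftrightarrow> poly r a \<noteq> 0"
proof -
  have nz: "p * [:c:] \<noteq> 0" using assms by auto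
  have "order a (p * [:c:]) = order a p + order a [:c:]" using nz by (rule order_mult)
  moreover have "order a [:c:] = 0" using assms by (simp add: order_0I)
  moreover have "order a (p * [:c:]) = 1 + order a r"
    using nz order_power_n_n[of a 1] unfolding assms(2)
    by (metis One_nat_def order_mult power_one_right)
  moreover have "order a r = 0 \<longleftrightarrow> poly r a \<noteq> 0"
    using nz assms(2) order_root[of r a] by auto
  ultimately show ?thesis by simp
qed

text \<open>
  Replacing the \<open>i\<close>-th column of the identity by \<open>\<psi>\<close> splits off a factor \<open>x - z\<close> of the
  characteristic polynomial; the remaining factor at \<open>z\<close> is the determinant of a matrix with
  columns \<open>\<psi>\<close> and \<open>(z - A) e\<^sub>k\<close> for \<open>k \<noteq> i\<close>.
\<close>

lemma simple_eigenvalue_iff: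
  fixes A :: "complex^'n^'n"
  assumes A: "A *v \<psi> = z *s \<psi>" and "\<psi> \<noteq> 0" and nz: "charpoly A \<noteq> 0"
  shows "order z (charpoly A) = 1 \<longleftrightarrow>
    (\<forall>v. A *v v = z *s v \<longrightarrow> (\<exists>c. v = c *s \<psi>)) \<and> (\<nexists>v. z *s v - A *v v = \<psi>)"
proof -
  obtain i where i: "\<psi> $ i \<noteq> 0" using \<open>\<psi> \<noteq> 0\<close> by (auto simp: vec_eq_iff)
  let ?X = "mat [:0, 1:] - (\<chi> i j. [:A $ i $ j:]) :: complex poly^'n^'n"
  \<comment> \<open>The columns of the modified identity are stored as rows, hence the products with
    \<open>transpose ?X\<close>.\<close>
  let ?S = "\<chi> k. if k = i then (\<chi> j. [:\<psi> $ j:]) else axis k 1 :: complex poly^'n^'n"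
  define R where "R = (\<chi> k. if k = i then (\<chi> j. [:\<psi> $ j:]) else (\<chi> j. ?X $ j $ k))"
  have SX: "(?S ** transpose ?X) $ i = [:-z, 1:] *s (\<chi> j. [:\<psi> $ j:])"
  proof -
    have "(\<Sum>k\<in>UNIV. [:\<psi> $ k:] * ?X $ j $ k) = [:-z, 1:] * [:\<psi> $ j:]" for j
    proof -
      have "(\<Sum>k\<in>UNIV. A $ j $ k * \<psi> $ k) = z * \<psi> $ j"
        using A by (auto simp: vec_eq_iff matrix_vector_mult_def)
      moreover have "(\<Sum>k\<in>UNIV. [:\<psi> $ k:] * ?X $ j $ k) =
        (\<Sum>k\<in>UNIV. (if j = k then [:0, \<psi> $ j:] else 0) - [:A $ j $ k * \<psi> $ k:])"
        by (intro sum.cong) (auto simp: mat_def algebra_simps)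
      moreover have "(\<Sum>k\<in>UNIV. [:A $ j $ k * \<psi> $ k:]) = [:\<Sum>k\<in>UNIV. A $ j $ k * \<psi> $ k:]"
        by (induction rule: finite_induct[OF finite[of UNIV]]) auto
      ultimately show ?thesis
        by (simp add: sum_subtractf)
    qed
    then show ?thesis
      by (simp add: vec_eq_iff matrix_matrix_mult_def transpose_def)
  qed
  have S: "(?S ** transpose ?X) $ k = (\<chi> j. ?X $ j $ k)" if "k \<noteq> i" for k
  proof -
    have "(\<Sum>l\<in>UNIV. ?S $ k $ l * ?X $ j $ l) = (\<Sum>l\<in>UNIV. if l = k then ?X $ j $ l else 0)" for j
      using that by (intro sum.cong) (auto simp: axis_def)
    then show ?thesis by (simp add: vec_eq_iff matrix_matrix_mult_def transpose_def)
  qed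
  have "det (?S ** transpose ?X) = [:-z, 1:] * det R"
  proof -
    have "?S ** transpose ?X = (\<chi> k. if k = i then [:-z, 1:] *s (\<chi> j. [:\<psi> $ j:]) else (\<chi> j. ?X $ j $ k))"
      using SX S by (auto simp: vec_eq_iff)
    then show ?thesis unfolding R_def
      using det_row_mul[of i "[:-z, 1:]" "\<lambda>_. \<chi> j. [:\<psi> $ j:]" "\<lambda>k. \<chi> j. ?X $ j $ k"] by (simp only:)
  qed
  moreover have "det (transpose ?X) = charpoly A" by (simp add: charpoly_def)
  moreover have "det ?S = [:\<psi> $ i:]"
  proof -
    \<comment> \<open>Cramer's lemma for the identity matrix evaluates the determinant of
      \<open>?S\<close>.\<close>
    let ?C = "\<chi> a j. if j = i then (mat 1 *v \<psi>) $ a else mat 1 $ a $ j"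
    have "?C = (\<chi> a j. if j = i then \<psi> $ a else mat 1 $ a $ j)" by (simp cong: if_cong)
    then have "(\<chi> k j. poly (?S $ k $ j) x) = transpose ?C" for x
      by (auto simp only: vec_eq_iff transpose_def vec_lambda_beta) (auto simp: axis_def mat_def)
    then have "poly (det ?S) x = \<psi> $ i" for x
      by (simp only: poly_det det_transpose cramer_lemma det_I mult_1_right)
    then show ?thesis
      by (simp add: poly_eq_poly_eq_iff[symmetric] fun_eq_iff)
  qed
  ultimately have *: "charpoly A * [:\<psi> $ i:] = [:-z, 1:] * det R"
    by (simp add: det_mul mult.commute)
  define T where "T = (\<chi> k j. poly (R $ k $ j) z)"
  \<comment> \<open>Coordinate \<open>i\<close> of \<open>x\<close> is the coefficient of \<psi>;
    the others form \<open>y\<close> with \<open>y $ i = 0\<close>. Kernel vectors thus encode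
    relations between \<psi> and the range of \<open>z - A\<close>.\<close>
  have T: "transpose T *v x = x $ i *s \<psi> + (z *s y - A *v y)" if "y = (\<chi> k. if k = i then 0 else x $ k)" for x y
  proof -
    have "(transpose T *v x) $ j = x $ i * \<psi> $ j + ((mat z - A) *v y) $ j" for j
    proof -
      have "(transpose T *v x) $ j =
        (\<Sum>k\<in>UNIV. (if k = i then x $ i * \<psi> $ j else 0) + (mat z - A) $ j $ k * y $ k)"
        unfolding matrix_vector_mult_def that T_def R_def transpose_def
        by (auto intro!: sum.cong simp: mat_def)
      then show ?thesis by (simp add: sum.distrib matrix_vector_mult_def)
    qed
    then show ?thesis by (simp add: vec_eq_iff matrix_vector_mult_diff_rdistrib mat_vector_mult)
  qed
  have "order z (charpoly A) = 1 \<longleftrightarrow> invertible (transpose T)"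
    using order_eq_1_iff[OF nz * i] by (simp add: poly_det T_def invertible_det_nz)
  \<comment> \<open>The first conjunct is geometric multiplicity one, the second excludes a Jordan
    chain ending in \<psi>.\<close>
  also have "\<dots> \<longleftrightarrow> (\<forall>v. A *v v = z *s v \<longrightarrow> (\<exists>c. v = c *s \<psi>)) \<and> (\<nexists>v. z *s v - A *v v = \<psi>)"
    (is "_ \<longleftrightarrow> ?K \<and> ?R")
  proof
    assume inv: "invertible (transpose T)"
    have split: "\<exists>w c. w $ i = 0 \<and> v = w + c *s \<psi>" for v
      by (rule exI[of _ "v - (v $ i / \<psi> $ i) *s \<psi>"], rule exI[of _ "v $ i / \<psi> $ i"]) (simp add: i)
    have zero: "w = 0 \<and> c = 0" if "w $ i = 0" "c *s \<psi> + (z *s w - A *v w) = 0" for w c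
    proof -
      have eq: "w = (\<chi> k. if k = i then 0 else (w + axis i c) $ k)"
        using that(1) by (auto simp: vec_eq_iff axis_def)
      have "transpose T *v (w + axis i c) = 0"
        using that by (subst T[OF eq]) (simp add: axis_def)
      then have "w + axis i c = 0" using inv invertible_iff_kernel by blast
      then have "\<forall>k. (w + axis i c) $ k = 0" by simp
      then have "(w + axis i c) $ i = 0" "\<And>k. k \<noteq> i \<Longrightarrow> (w + axis i c) $ k = 0" by blast+
      then show ?thesis using that(1) by (auto simp: axis_def vec_eq_iff) metis
    qed
    have sub: "z *s (w + c *s \<psi>) - A *v (w + c *s \<psi>) = z *s w - A *v w" for w c
      by (simp add: matrix_vector_right_distrib matrix_vector_mult_smult A vector_add_ldistrib vector_smult_assoc mult.commute)
    show "?K \<and> ?R"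
    proof (intro conjI allI impI notI)
      fix v assume v: "A *v v = z *s v"
      obtain w c where w: "w $ i = 0" "v = w + c *s \<psi>" using split by blast
      have "z *s w - A *v w = 0" using v sub[of w c] w(2) by simp
      then have "w = 0" using zero[of w 0] w(1) by simp
      then show "\<exists>c. v = c *s \<psi>" using w by auto
    next
      assume "\<exists>v. z *s v - A *v v = \<psi>"
      then obtain v where v: "z *s v - A *v v = \<psi>" by blast
      obtain w c where w: "w $ i = 0" "v = w + c *s \<psi>" using split by blast
      have "z *s w - A *v w = \<psi>" using v sub[of w c] w(2) by simp
      then show False using zero[of w "-1"] w(1) by simp
    qed
  next
    assume KR: "?K \<and> ?R"
    show "invertible (transpose T)"
      unfolding invertible_iff_kernel
    proof (intro allI impI)
      fix x assume x: "transpose T *v x = 0"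
      define y where "y = (\<chi> k. if k = i then 0 else x $ k)"
      have eq: "x $ i *s \<psi> + (z *s y - A *v y) = 0" using T[OF y_def] x by simp
      have "x $ i = 0"
      proof (rule ccontr)
        assume n: "x $ i \<noteq> 0"
        have "z *s y - A *v y = - (x $ i *s \<psi>)" using eq by (metis add_eq_0_iff)
        then have "(-1 / x $ i) *s (z *s y - A *v y) = \<psi>"
          using n by (simp only: vec_eq_iff vector_smult_component vector_uminus_component) simp
        then have "z *s ((-1 / x $ i) *s y) - A *v ((-1 / x $ i) *s y) = \<psi>"
          unfolding matrix_vector_mult_smult by (simp only: vec_eq_iff) (simp add: algebra_simps)
        then show False using KR by blast
      qed
      then have "A *v y = z *s y" using eq by simp
      then obtain c where c: "y = c *s \<psi>" using KR by blast
      have "y $ i = 0" by (simp add: y_def)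
      then have "y = 0" using c i by simp
      then show "x = 0" using \<open>x $ i = 0\<close> by (auto simp: y_def vec_eq_iff) metis
    qed
  qed
  finally show ?thesis .
qed

subsection \<open>Riesz projections and Cesaro means\<close>

lemma holomorphic_on_det:
  fixes A :: "complex \<Rightarrow> complex^'n^'n"
  assumes "\<And>i j. (\<lambda>z. A z $ i $ j) holomorphic_on S"
  shows "(\<lambda>z. det (A z)) holomorphic_on S"
  unfolding det_def using assms by (intro holomorphic_intros)

lemma riesz_radius:
  assumes "finite (spectrum A)"
  shows "0 < riesz_radius A z" and "spectrum A \<inter> cball z (riesz_radius A z) \<subseteq> {z}"
proof -
  obtain d where d: "0 < d" "\<forall>x\<in>spectrum A. x \<noteq> z \<longrightarrow> d \<le> dist z x"
    using finite_set_avoid[OF assms, of z] by blast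
  \<comment> \<open>Half the distance, so that the closed disc also misses the eigenvalue nearest to
    \<open>z\<close>.\<close>
  then have "0 < d / 2 \<and> spectrum A \<inter> cball z (d / 2) \<subseteq> {z}"
    by force
  then have "0 < riesz_radius A z \<and> spectrum A \<inter> cball z (riesz_radius A z) \<subseteq> {z}"
    unfolding riesz_radius_def by (rule someI)
  then show "0 < riesz_radius A z" and "spectrum A \<inter> cball z (riesz_radius A z) \<subseteq> {z}"
    by auto
qed

text \<open>
  Shifting \<open>A\<close> by \<open>- c E\<close> moves the eigenvalue 1 out of the disc without affecting the resolvent
  on the kernel of \<open>E\<close>, so there the resolvent extends holomorphically to the whole disc.
\<close>

lemma riesz_projection_eqI:
  fixes A E :: "complex^'n^'n"
  assumes AE: "\<And>v. A *v (E *v v) = E *v v" and EA: "\<And>v. E *v (A *v v) = E *v v"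
    and fixed: "\<And>v. A *v v = v \<Longrightarrow> E *v v = v" and fin: "finite (spectrum A)"
  shows "riesz_projection A 1 = E"
proof -
  define r where "r = riesz_radius A 1"
  have r: "0 < r" "spectrum A \<inter> cball 1 r \<subseteq> {1}"
    using riesz_radius[OF fin, of 1] by (auto simp: r_def)
  \<comment> \<open>On the range of \<open>E\<close> the shifted matrix acts as
    \<open>\<zeta> - 1 + c\<close>. Its zero lies at distance \<open>c\<close> from 1, outside the
    disc of radius \<open>r\<close>.\<close>
  define c where "c = r + 1"
  define G where "G \<zeta> = mat \<zeta> - A + c *\<^sub>R E" for \<zeta>
  have EE: "E *v (E *v v) = E *v v" for v using AE fixed by blast
  have G: "G \<zeta> *v v = \<zeta> *s v - A *v v + c *\<^sub>R (E *v v)" for \<zeta> v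
    by (simp add: G_def matrix_vector_mult_add_rdistrib matrix_vector_mult_diff_rdistrib
        mat_vector_mult smult_scaleR_matrix_vector_mult)
  have EG: "E *v (G \<zeta> *v v) = (\<zeta> - 1 + c) *s (E *v v)" for \<zeta> v
    by (simp add: G matrix_vector_right_distrib matrix_vector_mult_diff_distrib EA EE
        matrix_vector_mult_smult scaleR_eq_vector_smult algebra_simps)
  have E0: "E *v v = 0" if "E *v (G \<zeta> *v v) = 0" "\<zeta> \<in> cball 1 r" for \<zeta> v
  proof -
    have "\<zeta> - 1 + c \<noteq> 0"
    proof
      assume "\<zeta> - 1 + c = 0"
      then have "1 - \<zeta> = of_real c" by (simp add: algebra_simps)
      then have "cmod (1 - \<zeta>) = \<bar>c\<bar>" by (metis norm_of_real)
      then show False using that(2) r(1) by (simp add: dist_norm c_def)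
    qed
    then show ?thesis using that(1) EG by (metis vector_mul_eq_0)
  qed
  have inv: "invertible (G \<zeta>)" if "\<zeta> \<in> cball 1 r" for \<zeta>
    unfolding invertible_iff_kernel
  proof (intro allI impI)
    fix v assume v: "G \<zeta> *v v = 0"
    have "E *v v = 0" using E0[OF _ that] v by simp
    then have Av: "A *v v = \<zeta> *s v" using v by (simp add: G)
    show "v = 0"
    proof (cases "\<zeta> = 1")
      case True
      then show ?thesis using fixed[of v] Av \<open>E *v v = 0\<close> by simp
    next
      case False
      then have "\<zeta> \<notin> spectrum A" using r(2) that by auto
      then show ?thesis using Av mem_spectrum_iff by blast
    qed
  qed
  have entry: "riesz_projection A 1 $ i $ j = E $ i $ j" for i j
  proof -
    define b where "b = axis j 1 - E *v axis j 1"
    \<comment> \<open>By Cramer's rule this is coordinate \<open>i\<close> of the solution of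
      \<open>G \<zeta> *v y = b\<close>, a quotient of polynomials in \<zeta> whose denominator has
      no zero on the disc.\<close>
    define h where "h \<zeta> = det (\<chi> a l. if l = i then b $ a else G \<zeta> $ a $ l) / det (G \<zeta>)" for \<zeta>
    have hol: "(\<lambda>\<zeta>. G \<zeta> $ a $ l) holomorphic_on S" for a l S
      by (cases "a = l") (auto simp: G_def mat_def intro!: holomorphic_intros)
    have "h holomorphic_on cball 1 r"
      unfolding h_def
    proof (intro holomorphic_on_divide holomorphic_on_det)
      fix a l show "(\<lambda>\<zeta>. (\<chi> a l. if l = i then b $ a else G \<zeta> $ a $ l) $ a $ l) holomorphic_on cball 1 r"
        by (cases "l = i") (simp_all add: hol)
    next
      show "det (G \<zeta>) \<noteq> 0" if "\<zeta> \<in> cball 1 r" for \<zeta>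
        using inv[OF that] by (simp add: invertible_det_nz)
    qed (rule hol)
    then have h0: "(h has_contour_integral 0) (circlepath 1 r)"
      by (rule Cauchy_theorem_convex_simple) (use r in \<open>auto simp: dist_norm\<close>)
    have E1: "((\<lambda>\<zeta>. E $ i $ j / (\<zeta> - 1)) has_contour_integral (2 * of_real pi * \<i> * E $ i $ j)) (circlepath 1 r)"
      by (rule Cauchy_integral_circlepath_simple) (use r in auto)
    have "((\<lambda>\<zeta>. matrix_inv (mat \<zeta> - A) $ i $ j) has_contour_integral (2 * of_real pi * \<i> * E $ i $ j)) (circlepath 1 r)"
    proof (rule has_contour_integral_eq)
      \<comment> \<open>The basis vector is split along \<open>E\<close>: its range part yields the
        simple pole with residue \<open>E $ i $ j\<close>, its kernel part the holomorphic
        \<open>h\<close>.\<close>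
      show "((\<lambda>\<zeta>. E $ i $ j / (\<zeta> - 1) + h \<zeta>) has_contour_integral (2 * of_real pi * \<i> * E $ i $ j)) (circlepath 1 r)"
        using has_contour_integral_add[OF E1 h0] by simp
      fix \<zeta> assume "\<zeta> \<in> path_image (circlepath 1 r)"
      then have \<zeta>: "\<zeta> \<in> cball 1 r" "\<zeta> \<noteq> 1" using r(1) by (auto simp: dist_norm)
      then have R: "invertible (mat \<zeta> - A)" using r(2) by (auto simp: spectrum_def)
      define y where "y = matrix_inv (G \<zeta>) *v b"
      have Gy: "G \<zeta> *v y = b" unfolding y_def using matrix_inv_vector_mult(1)[OF inv[OF \<zeta>(1)]] .
      have "E *v (G \<zeta> *v y) = 0" by (simp add: Gy b_def matrix_vector_mult_diff_distrib EE)
      then have "E *v y = 0" using E0 \<zeta>(1) by blast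
      then have "(mat \<zeta> - A) *v y = b"
        using Gy by (simp add: G matrix_vector_mult_diff_rdistrib mat_vector_mult)
      moreover have "(mat \<zeta> - A) *v ((1 / (\<zeta> - 1)) *s (E *v axis j 1)) = E *v axis j 1"
      proof -
        have "(mat \<zeta> - A) *v (E *v axis j 1) = (\<zeta> - 1) *s (E *v axis j 1)"
          by (simp add: matrix_vector_mult_diff_rdistrib mat_vector_mult AE vector_sub_rdistrib)
        then show ?thesis
          using \<zeta>(2) by (simp only: matrix_vector_mult_smult vector_smult_assoc) simp
      qed
      ultimately have "(mat \<zeta> - A) *v ((1 / (\<zeta> - 1)) *s (E *v axis j 1) + y) = axis j 1"
        by (simp add: matrix_vector_right_distrib b_def)
      then have "matrix_inv (mat \<zeta> - A) *v axis j 1 = (1 / (\<zeta> - 1)) *s (E *v axis j 1) + y"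
        using matrix_inv_vector_mult(2)[OF R] by metis
      moreover have "(B *v axis j 1) $ i = B $ i $ j" for B :: "complex^'n^'n"
        by (simp add: matrix_vector_mult_def axis_def if_distrib[of "\<lambda>x. _ * x"] cong: if_cong)
      moreover have "y $ i = h \<zeta>"
        using Gy cramer[of "G \<zeta>" y b] inv[OF \<zeta>(1)] by (simp add: invertible_det_nz h_def)
      ultimately show "E $ i $ j / (\<zeta> - 1) + h \<zeta> = matrix_inv (mat \<zeta> - A) $ i $ j"
        by (metis (no_types, lifting) vector_add_component vector_smult_component times_divide_eq_left mult_1)
    qed
    then show ?thesis
      by (simp add: riesz_projection_def r_def[symmetric] contour_integral_unique)
  qed
  then show ?thesis by (simp add: vec_eq_iff)
qed

section \<open>Powers and Cesaro means of matrices\<close>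

definition matrix_power :: "complex^'n^'n \<Rightarrow> nat \<Rightarrow> complex^'n^'n" where
  "matrix_power A k = ((\<lambda>B. A ** B) ^^ k) (mat 1)"

text \<open>For \<open>K = 0\<close> division by zero yields the zero matrix: contractivity
  survives, but fixed vectors are preserved only for \<open>0 < K\<close>.\<close>

definition cesaro :: "complex^'n^'n \<Rightarrow> nat \<Rightarrow> complex^'n^'n" where
  "cesaro A K = (1 / real K) *\<^sub>R (\<Sum>k<K. matrix_power A k)"

lemma matrix_power_0 [simp]: "matrix_power A 0 *v v = v"
  by (simp add: matrix_power_def)

lemma matrix_power_Suc: "matrix_power A (Suc k) *v v = A *v (matrix_power A k *v v)"
  by (simp add: matrix_power_def matrix_vector_mul_assoc)

lemma sum_matrix_vector_mult: "(\<Sum>k\<in>S. A k) *v v = (\<Sum>k\<in>S. A k *v v)"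
  for A :: "'b \<Rightarrow> complex^'n^'m"
  by (induction S rule: infinite_finite_induct) (simp_all add: matrix_vector_mult_add_rdistrib)

lemma cesaro_vector_mult: "cesaro A K *v v = (1 / real K) *\<^sub>R (\<Sum>k<K. matrix_power A k *v v)"
  by (simp add: cesaro_def smult_scaleR_matrix_vector_mult sum_matrix_vector_mult)

lemma matrix_power_fixed: "A *v v = v \<Longrightarrow> matrix_power A k *v v = v"
  by (induction k) (simp_all add: matrix_power_Suc)

lemma matrix_power_commute: "matrix_power A k *v (A *v v) = A *v (matrix_power A k *v v)"
  by (induction k) (simp_all add: matrix_power_Suc)

lemma tendsto_matrixI:
  fixes A :: "nat \<Rightarrow> complex^'n^'m"
  assumes "\<And>v. (\<lambda>k. A k *v v) \<longlonglongrightarrow> f v"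
  shows "A \<longlonglongrightarrow> (\<chi> i j. f (axis j 1) $ i)"
proof (intro vec_tendstoI)
  fix i j
  have "(B *v axis j 1) $ i = B $ i $ j" for B :: "complex^'n^'m"
    by (simp add: matrix_vector_mult_def axis_def if_distrib[of "\<lambda>x. _ * x"] cong: if_cong)
  then show "(\<lambda>k. A k $ i $ j) \<longlonglongrightarrow> (\<chi> i j. f (axis j 1) $ i) $ i $ j"
    using tendsto_vec_nth[OF assms[of "axis j 1"], of i] by simp
qed

lemma tendsto_matrix_vector_mult [tendsto_intros]:
  fixes f :: "'a \<Rightarrow> complex^'n^'m"
  assumes "(f \<longlongrightarrow> A) F" "(g \<longlongrightarrow> v) F"
  shows "((\<lambda>x. f x *v g x) \<longlongrightarrow> A *v v) F"
proof (intro vec_tendstoI)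
  fix i show "((\<lambda>x. (f x *v g x) $ i) \<longlongrightarrow> (A *v v) $ i) F"
    using assms by (auto simp: matrix_vector_mult_def intro!: tendsto_intros)
qed

text \<open>Kernel and range meet only in 0, so \<open>T\<close> is injective on its range and, by
  dimension, maps it onto itself; hence \<open>T v = T (T u)\<close> for some \<open>u\<close>. For
  \<open>T = 1 - A\<close> this splits a vector into a fixed vector and a coboundary.\<close>

lemma kernel_range_decomposition:
  fixes T :: "'a::euclidean_space \<Rightarrow> 'a"
  assumes "linear T" and triv: "\<And>v. T (T v) = 0 \<Longrightarrow> T v = 0"
  obtains u where "T (v - T u) = 0"
proof -
  have sub: "subspace (range T)" using assms(1) by (simp add: linear_subspace_image)
  have inj: "inj_on T (range T)"
  proof (rule inj_onI)
    fix x y assume "x \<in> range T" "y \<in> range T" and eq: "T x = T y"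
    then obtain a b where ab: "x = T a" "y = T b" by auto
    then have "T (T (a - b)) = 0" using eq assms(1) by (simp add: linear_diff)
    then have "T (a - b) = 0" by (rule triv)
    then show "x = y" using ab assms(1) by (simp add: linear_diff)
  qed
  have "dim (T ` range T) = dim (range T)"
    using sub inj assms(1) by (intro dim_image_eq) (simp_all add: span_eq_iff[THEN iffD2])
  then have "T ` range T = range T"
    using sub assms(1) by (intro subspace_dim_equal) (auto simp: linear_subspace_image)
  then obtain w where "T v = T (T w)" by (metis (no_types, lifting) image_iff rangeI)
  then have "T (v - T w) = 0" using assms(1) by (simp add: linear_diff)
  then show thesis by (rule that)
qed

section \<open>Contractions for an arbitrary norm\<close>

locale complex_norm =
  fixes N :: "complex^'n \<Rightarrow> real"
  assumes is_norm: "is_norm N"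
begin

lemma N_nonneg [simp]: "0 \<le> N v"
  and N_eq_0 [simp]: "N v = 0 \<longleftrightarrow> v = 0"
  and N_smult: "N (c *s v) = cmod c * N v"
  and N_triangle: "N (v + w) \<le> N v + N w"
  using is_norm by (auto simp: is_norm_def)

lemma N_minus: "N (- v) = N v"
  using N_smult[of "-1" v] by simp

lemma N_scaleR: "N (r *\<^sub>R v) = \<bar>r\<bar> * N v"
  by (simp add: scaleR_eq_vector_smult N_smult)

lemma N_sum: "N (\<Sum>k\<in>S. f k) \<le> (\<Sum>k\<in>S. N (f k))"
  by (induction S rule: infinite_finite_induct) (auto intro: order_trans[OF N_triangle] simp: N_eq_0[THEN iffD2])

text \<open>Expansion in the standard basis. This half of the equivalence with the Euclidean norm
  makes \<open>N\<close> Lipschitz, which the other half needs.\<close>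

lemma N_upper: obtains C where "C \<ge> 0" "\<And>v. N v \<le> C * norm v"
proof
  show "N v \<le> (\<Sum>i\<in>UNIV. N (axis i 1)) * norm v" for v
  proof -
    have "v = (\<Sum>i\<in>UNIV. (v $ i) *s axis i 1)"
      by (simp add: vec_eq_iff axis_def if_distrib[of "\<lambda>x. _ * x"] cong: if_cong)
    then have "N v \<le> (\<Sum>i\<in>UNIV. cmod (v $ i) * N (axis i 1))"
      using N_sum[of "\<lambda>i. (v $ i) *s axis i 1" UNIV] by (simp add: N_smult)
    also have "\<dots> \<le> (\<Sum>i\<in>UNIV. norm v * N (axis i 1))"
      by (intro sum_mono mult_right_mono) (auto simp: Finite_Cartesian_Product.norm_nth_le)
    finally show ?thesis by (simp add: sum_distrib_left mult.commute)
  qed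
qed (simp add: sum_nonneg)

lemma N_continuous: "continuous_on S N"
proof -
  obtain C where C: "C \<ge> 0" "\<And>v. N v \<le> C * norm v" using N_upper by blast
  have "dist (N v) (N w) \<le> C * dist v w" for v w
  proof -
    have "N v \<le> N w + N (v - w)" "N w \<le> N v + N (v - w)"
      using N_triangle[of w "v - w"] N_triangle[of v "w - v"] N_minus[of "v - w"] by simp_all
    then show ?thesis using C(2)[of "v - w"] by (simp add: dist_norm)
  qed
  then have "C-lipschitz_on S N" using C(1) by (intro lipschitz_onI)
  then show ?thesis by (rule lipschitz_on_continuous_on)
qed

lemma tendsto_N: "(f \<longlongrightarrow> v) F \<Longrightarrow> ((\<lambda>x. N (f x)) \<longlongrightarrow> N v) F"
  using N_continuous[of UNIV] by (auto intro: continuous_on_tendsto_compose)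

text \<open>By compactness \<open>N\<close> has a positive minimum on the Euclidean unit sphere;
  scaling gives the rest.\<close>

lemma N_lower: obtains c where "c > 0" "\<And>v. norm v \<le> c * N v"
proof -
  have ne: "sphere (0 :: complex^'n) 1 \<noteq> {}"
    using vector_choose_size[of 1] by (auto simp: dist_norm)
  obtain x where x: "x \<in> sphere 0 1" "\<And>y. y \<in> sphere 0 1 \<Longrightarrow> N x \<le> N y"
    using continuous_attains_inf[OF compact_sphere ne N_continuous] by blast
  then have "N x > 0" by (metis N_eq_0 N_nonneg less_eq_real_def mem_sphere_0 norm_zero zero_neq_one)
  moreover have "norm v \<le> (1 / N x) * N v" for v
  proof (cases "v = 0")
    case False
    then have "N x \<le> N ((1 / norm v) *\<^sub>R v)" by (intro x(2)) simp
    then have "N x \<le> N v / norm v" by (simp add: N_scaleR)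
    then show ?thesis using False \<open>N x > 0\<close> by (simp add: field_simps)
  qed simp
  ultimately show thesis using that[of "1 / N x"] by simp
qed

text \<open>Stated on vectors, so that boundedness of the supremum in \<open>induced_norm\<close>
  never has to be proved: only the passage from here to \<open>induced_norm N A \<le> 1\<close> is
  used.\<close>

definition contractive :: "complex^'n^'n \<Rightarrow> bool" where
  "contractive A \<longleftrightarrow> (\<forall>v. N (A *v v) \<le> N v)"

lemma contractive_power: "contractive A \<Longrightarrow> N (matrix_power A k *v v) \<le> N v"
  by (induction k) (auto simp: matrix_power_Suc contractive_def intro: order_trans)

lemma contractive_cesaro: "contractive A \<Longrightarrow> contractive (cesaro A K)"
  unfolding contractive_def
proof
  fix v assume "\<forall>v. N (A *v v) \<le> N v"
  then have A: "contractive A" by (simp add: contractive_def)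
  have "N (\<Sum>k<K. matrix_power A k *v v) \<le> (\<Sum>k<K. N v)"
    by (rule order_trans[OF N_sum sum_mono]) (rule contractive_power[OF A])
  then show "N (cesaro A K *v v) \<le> N v"
    by (cases "K = 0") (auto simp: N_eq_0[THEN iffD2] cesaro_vector_mult N_scaleR field_simps)
qed

lemma contractive_remainder:
  assumes "contractive A"
  shows "(\<lambda>K. (1 / real K) *\<^sub>R (matrix_power A K *v v)) \<longlonglongrightarrow> 0"
proof -
  obtain c where c: "c > 0" "\<And>v. norm v \<le> c * N v" using N_lower by blast
  have "norm (matrix_power A K *v v) \<le> c * N v" for K
    using c(2)[of "matrix_power A K *v v"] contractive_power[OF assms, of K v] c(1)
    by (meson mult_left_mono less_imp_le order_trans)
  then have "norm ((1 / real K) *\<^sub>R (matrix_power A K *v v)) \<le> (c * N v) / real K" for K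
    by (simp add: divide_right_mono)
  then show ?thesis
    by (intro Lim_null_comparison[OF _ lim_const_over_n[of "c * N v"]]) simp
qed

lemma cesaro_coboundary: "cesaro A K *v (u - A *v u) = (1 / real K) *\<^sub>R (u - matrix_power A K *v u)"
proof -
  have "(\<Sum>k<K. matrix_power A k *v (u - A *v u)) = u - matrix_power A K *v u"
    by (induction K) (simp_all add: matrix_power_Suc matrix_vector_mult_diff_distrib matrix_power_commute)
  then show ?thesis by (simp add: cesaro_vector_mult)
qed

lemma cesaro_fixed: "A *v v = v \<Longrightarrow> 0 < K \<Longrightarrow> cesaro A K *v v = v"
  by (simp add: cesaro_vector_mult matrix_power_fixed sum_constant_scaleR del: sum_constant)

text \<open>The mean ergodic theorem in finite dimension: every vector is a fixed vector plus a
  coboundary \<open>u - A *v u\<close>; the means keep the former and send the latter to 0.\<close>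

lemma cesaro_converges:
  assumes A: "contractive A"
  obtains E where "cesaro A \<longlonglongrightarrow> E"
    "\<And>v. A *v (E *v v) = E *v v" "\<And>v. E *v (A *v v) = E *v v" "\<And>v. A *v v = v \<Longrightarrow> E *v v = v"
proof -
  have cob: "(\<lambda>K. cesaro A K *v (u - A *v u)) \<longlonglongrightarrow> 0" for u
  proof -
    have "(\<lambda>K. (1 / real K) *\<^sub>R u - (1 / real K) *\<^sub>R (matrix_power A K *v u)) \<longlonglongrightarrow> 0 *\<^sub>R u - 0"
      by (intro tendsto_diff tendsto_scaleR contractive_remainder[OF A] lim_const_over_n tendsto_const)
    then show ?thesis by (simp add: cesaro_coboundary scaleR_diff_right)
  qed
  have fixed: "(\<lambda>K. cesaro A K *v k) \<longlonglongrightarrow> k" if "A *v k = k" for k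
    by (rule tendsto_eventually) (use that cesaro_fixed in \<open>auto simp: eventually_at_top_dense intro!: exI[of _ 0]\<close>)
  have dec: "\<exists>k u. A *v k = k \<and> v = k + (u - A *v u)" for v
  proof -
    let ?T = "\<lambda>v. v - A *v v"
    have lin: "linear ?T"
      by (rule linearI) (simp_all add: matrix_vector_right_distrib matrix_vector_mult_smult scaleR_eq_vector_smult vector_ssub_ldistrib)
    \<comment> \<open>A coboundary that is itself fixed has means that are eventually constant and
      also tend to 0, so it vanishes.\<close>
    have triv: "?T w = 0" if "?T (?T w) = 0" for w
      using LIMSEQ_unique[OF cob[of w] fixed] that by simp
    obtain u where "?T (v - ?T u) = 0"
      using kernel_range_decomposition[OF lin triv] by blast
    then show ?thesis by (intro exI[of _ "v - ?T u"] exI[of _ u]) simp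
  qed
  have lim: "(\<lambda>K. cesaro A K *v v) \<longlonglongrightarrow> k" if "A *v k = k" "v = k + (u - A *v u)" for v k u
    using tendsto_add[OF fixed cob] that by (simp add: matrix_vector_right_distrib)
  define f where "f v = lim (\<lambda>K. cesaro A K *v v)" for v
  have "(\<lambda>K. cesaro A K *v v) \<longlonglongrightarrow> f v" for v
    unfolding f_def using dec[of v] lim by (metis convergentI convergent_LIMSEQ_iff)
  then obtain E where E: "cesaro A \<longlonglongrightarrow> E" using tendsto_matrixI by blast
  have val: "E *v v = k" if "A *v k = k" "v = k + (u - A *v u)" for v k u
    using LIMSEQ_unique[OF tendsto_matrix_vector_mult[OF E tendsto_const] lim[OF that]] .
  show thesis
  proof
    fix v
    obtain k u where ku: "A *v k = k" "v = k + (u - A *v u)" using dec by blast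
    show "A *v (E *v v) = E *v v" using val[OF ku] ku by simp
    have "A *v v = k + (A *v u - A *v (A *v u))"
      using ku by (simp add: matrix_vector_right_distrib matrix_vector_mult_diff_distrib)
    then show "E *v (A *v v) = E *v v" using val[OF ku(1)] val[OF ku] by blast
    show "E *v v = v" if "A *v v = v" using val[of v v 0] that by simp
  qed (rule E)
qed

lemma contractive_spectrum:
  assumes "contractive A" "z \<in> spectrum A"
  shows "cmod z \<le> 1"
proof -
  obtain v where v: "v \<noteq> 0" "A *v v = z *s v" using assms(2) mem_spectrum_iff by blast
  then have "cmod z * N v \<le> 1 * N v"
    using assms(1) unfolding contractive_def by (metis N_smult mult_1)
  moreover have "N v > 0" using v(1) by (metis N_eq_0 N_nonneg less_eq_real_def)
  ultimately show ?thesis by simp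
qed

text \<open>The point 2 lies outside the unit disc, hence is not a root; no leading coefficient is
  computed.\<close>

lemma contractive_charpoly: "contractive A \<Longrightarrow> charpoly A \<noteq> 0"
  using contractive_spectrum[of A 2] by (auto simp: mem_spectrum_iff_charpoly)

lemma contractive_finite_spectrum: "contractive A \<Longrightarrow> finite (spectrum A)"
proof -
  assume "contractive A"
  then have "finite {z. poly (charpoly A) z = 0}"
    by (intro poly_roots_finite contractive_charpoly)
  then show ?thesis by (simp flip: mem_spectrum_iff_charpoly)
qed

context
  fixes A :: "complex^'n^'n"
  assumes A: "contractive A"
begin

text \<open>The identities satisfied by the Cesaro limit are those that determine the contour
  integral, so both describe the same projection.\<close>

lemma riesz_projection_exists:
  "\<exists>E. cesaro A \<longlonglongrightarrow> E \<and> E = riesz_projection A 1 \<and> (\<forall>v. A *v (E *v v) = E *v v) \<and>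
     (\<forall>v. E *v (A *v v) = E *v v) \<and> (\<forall>v. A *v v = v \<longrightarrow> E *v v = v)"
  by (rule cesaro_converges[OF A])
     (metis riesz_projection_eqI contractive_finite_spectrum[OF A])

lemma cesaro_tendsto_riesz_projection: "cesaro A \<longlonglongrightarrow> riesz_projection A 1"
  and riesz_projection_left: "A *v (riesz_projection A 1 *v v) = riesz_projection A 1 *v v"
  and riesz_projection_right: "riesz_projection A 1 *v (A *v v) = riesz_projection A 1 *v v"
  and riesz_projection_fixed: "A *v v = v \<Longrightarrow> riesz_projection A 1 *v v = v"
  using riesz_projection_exists by blast+

text \<open>A limit of contractions. The bound does not depend on \<open>A\<close>, which later
  makes \<open>psi\<close> bounded uniformly in \<omega>.\<close>

lemma contractive_riesz_projection: "contractive (riesz_projection A 1)"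
  unfolding contractive_def
proof
  fix v
  show "N (riesz_projection A 1 *v v) \<le> N v"
    by (rule LIMSEQ_le_const2[OF tendsto_N[OF tendsto_matrix_vector_mult[OF cesaro_tendsto_riesz_projection tendsto_const]]])
       (use contractive_cesaro[OF A] in \<open>auto simp: contractive_def\<close>)
qed

end

end

subsection \<open>The mean operator\<close>

lemma bounded_linear_matrix_vector_mult: "bounded_linear (\<lambda>A :: complex^'n^'m. A *v v)"
  unfolding linear_conv_bounded_linear[symmetric]
  by (intro linearI)
     (simp_all add: matrix_vector_mult_add_rdistrib smult_scaleR_matrix_vector_mult)

lemma bounded_linear_cinner_right: "bounded_linear (cinner x)"
  unfolding linear_conv_bounded_linear[symmetric]
  by (intro linearI)
     (simp_all add: cinner_add_right scaleR_eq_vector_smult cinner_smult_right scaleR_conv_of_real)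

text \<open>Conjugate-linear in \<open>x\<close> over the complex field, but real-linear, which
  suffices to commute with a Bochner integral. The same holds for \<open>ketbra\<close>
  below.\<close>

lemma bounded_linear_cinner_left: "bounded_linear (\<lambda>x. cinner x y)"
  unfolding linear_conv_bounded_linear[symmetric]
  by (intro linearI)
     (simp_all add: cinner_add_left scaleR_eq_vector_smult cinner_smult_left scaleR_conv_of_real)

lemma bounded_linear_ketbra: "bounded_linear (ketbra \<psi>)"
  unfolding linear_conv_bounded_linear[symmetric]
  by (intro linearI)
     (auto simp: matrix_eq ketbra_vector_mult matrix_vector_mult_add_rdistrib cinner_add_left
        smult_scaleR_matrix_vector_mult scaleR_eq_vector_smult cinner_smult_left vector_smult_assoc)

lemma continuous_on_matrix_matrix_mult [continuous_intros]:
  fixes f :: "'a::topological_space \<Rightarrow> complex^'n^'m" and g :: "'a \<Rightarrow> complex^'k^'n"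
  assumes "continuous_on S f" "continuous_on S g"
  shows "continuous_on S (\<lambda>x. f x ** g x)"
  unfolding matrix_matrix_mult_def using assms by (intro continuous_intros)

lemma continuous_on_matrix_vector_mult [continuous_intros]:
  fixes f :: "'a::topological_space \<Rightarrow> complex^'n^'m" and g :: "'a \<Rightarrow> complex^'n"
  assumes "continuous_on S f" "continuous_on S g"
  shows "continuous_on S (\<lambda>x. f x *v g x)"
  unfolding matrix_vector_mult_def using assms by (intro continuous_intros)

lemma continuous_on_cadjoint [continuous_intros]:
  fixes f :: "'a::topological_space \<Rightarrow> complex^'n^'m"
  assumes "continuous_on S f"
  shows "continuous_on S (\<lambda>x. cadjoint (f x))"
  unfolding cadjoint_def using assms by (intro continuous_intros)

lemma continuous_on_matrix_power [continuous_intros]: "continuous_on S (\<lambda>A. matrix_power A k)"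
proof (induction k)
  case (Suc k)
  then have "continuous_on S (\<lambda>A. A ** matrix_power A k)"
    by (intro continuous_intros)
  then show ?case by (simp add: matrix_power_def)
qed (simp add: matrix_power_def)

lemma continuous_on_cesaro: "continuous_on S (\<lambda>A. cesaro A K)"
  unfolding cesaro_def by (intro continuous_intros)

lemma norm_matrix_le: "norm B \<le> (\<Sum>i\<in>UNIV. \<Sum>j\<in>UNIV. cmod (B $ i $ j))" for B :: "complex^'n^'m"
proof -
  have "norm B \<le> (\<Sum>i\<in>UNIV. norm (B $ i))"
    unfolding norm_vec_def[of B] by (rule L2_set_le_sum) simp
  also have "\<dots> \<le> (\<Sum>i\<in>UNIV. \<Sum>j\<in>UNIV. cmod (B $ i $ j))"
    unfolding norm_vec_def[of "B $ _"] by (intro sum_mono L2_set_le_sum) simp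
  finally show ?thesis .
qed

text \<open>Otherwise every point of \<open>S\<close> has a ball with null preimage, and countably
  many of these balls cover \<open>S\<close> by the Lindelof property. As \<open>S\<close> is
  arbitrary, the lemma applies to \<open>M_E\<close> without a proof that it is Borel.\<close>

lemma (in finite_measure) support_point:
  fixes f :: "'a \<Rightarrow> 'b::{metric_space, second_countable_topology}"
  assumes f: "f \<in> borel_measurable M" and pos: "0 < measure M {\<omega> \<in> space M. f \<omega> \<in> S}"
  obtains x where "x \<in> S" "\<And>e. 0 < e \<Longrightarrow> 0 < measure M {\<omega> \<in> space M. f \<omega> \<in> ball x e}"
proof (rule ccontr)
  assume "\<not> thesis"
  with that have "\<forall>x\<in>S. \<exists>e>0. measure M {\<omega> \<in> space M. f \<omega> \<in> ball x e} = 0"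
    by (metis zero_less_measure_iff)
  then obtain e where e: "\<And>x. x \<in> S \<Longrightarrow> 0 < e x"
      "\<And>x. x \<in> S \<Longrightarrow> measure M {\<omega> \<in> space M. f \<omega> \<in> ball x (e x)} = 0"
    by metis
  have null: "{\<omega> \<in> space M. f \<omega> \<in> ball x (e x)} \<in> null_sets M" if "x \<in> S" for x
    using e(2)[OF that] f by (auto simp: null_sets_def emeasure_eq_measure)
  obtain F where F: "F \<subseteq> (\<lambda>x. ball x (e x)) ` S" "countable F" "\<Union>F = (\<Union>x\<in>S. ball x (e x))"
    using Lindelof[of "(\<lambda>x. ball x (e x)) ` S"] by auto
  have "(\<Union>B\<in>F. {\<omega> \<in> space M. f \<omega> \<in> B}) \<in> null_sets M"
    using F(1) null by (intro null_sets_UN' F(2)) auto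
  then have 0: "measure M (\<Union>B\<in>F. {\<omega> \<in> space M. f \<omega> \<in> B}) = 0"
    "(\<Union>B\<in>F. {\<omega> \<in> space M. f \<omega> \<in> B}) \<in> sets M"
    by (auto simp: null_sets_def measure_def)
  have "{\<omega> \<in> space M. f \<omega> \<in> S} \<subseteq> (\<Union>B\<in>F. {\<omega> \<in> space M. f \<omega> \<in> B})"
  proof
    fix \<omega> assume \<omega>: "\<omega> \<in> {\<omega> \<in> space M. f \<omega> \<in> S}"
    then have "f \<omega> \<in> \<Union>F" unfolding F(3) using e(1) by force
    then show "\<omega> \<in> (\<Union>B\<in>F. {\<omega> \<in> space M. f \<omega> \<in> B})" using \<omega> by auto
  qed
  from finite_measure_mono[OF this 0(2)] 0(1) pos show False by simp
qed

context complex_norm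
begin

text \<open>The ball \<open>N v \<le> K\<close> is closed and convex. A mean outside it would be
  strictly separated from it by a real hyperplane, against monotonicity of the integral.\<close>

lemma N_integral_le:
  assumes "prob_space p" "integrable p f" "AE \<omega> in p. N (f \<omega>) \<le> K"
  shows "N (\<integral>\<omega>. f \<omega> \<partial>p) \<le> K"
proof (rule ccontr)
  interpret prob_space p by fact
  let ?S = "{v. N v \<le> K}"
  assume "\<not> ?thesis"
  then have "(\<integral>\<omega>. f \<omega> \<partial>p) \<notin> ?S" by simp
  moreover have "closed ?S"
    using N_continuous by (intro closed_Collect_le continuous_intros)
  moreover have "convex ?S"
  proof (rule convexI)
    fix x y and u v :: real assume *: "x \<in> ?S" "y \<in> ?S" "0 \<le> u" "0 \<le> v" "u + v = 1"
    have "N (u *\<^sub>R x + v *\<^sub>R y) \<le> u * N x + v * N y"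
      using N_triangle[of "u *\<^sub>R x" "v *\<^sub>R y"] *(3,4) by (simp add: N_scaleR)
    also have "\<dots> \<le> u * K + v * K" using * by (intro add_mono mult_left_mono) auto
    also have "\<dots> = K" using *(5) by (simp flip: distrib_right)
    finally show "u *\<^sub>R x + v *\<^sub>R y \<in> ?S" by simp
  qed
  ultimately obtain a b where ab: "a \<bullet> (\<integral>\<omega>. f \<omega> \<partial>p) < b" "\<And>x. x \<in> ?S \<Longrightarrow> b < a \<bullet> x"
    using separating_hyperplane_closed_point[of ?S "\<integral>\<omega>. f \<omega> \<partial>p"] by blast
  have "b \<le> (\<integral>\<omega>. a \<bullet> f \<omega> \<partial>p)"
    using assms(2,3) ab(2) by (intro integral_ge_const) (auto elim!: eventually_mono intro: less_imp_le)
  also have "\<dots> = a \<bullet> (\<integral>\<omega>. f \<omega> \<partial>p)"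
    using assms(2) by simp
  finally show False using ab(1) by simp
qed

text \<open>The entries are coordinates of \<open>A *v axis j 1\<close>, so the bound depends on
  \<open>N\<close> alone; it gives integrability of \<open>M\<close>.\<close>

lemma contractive_bounded: obtains C where "\<And>A. contractive A \<Longrightarrow> norm A \<le> C"
proof -
  obtain c where c: "c > 0" "\<And>v. norm v \<le> c * N v" using N_lower by blast
  show thesis
  proof
    fix A assume A: "contractive A"
    have "cmod (A $ i $ j) \<le> c * N (axis j 1)" for i j
    proof -
      have "A $ i $ j = (A *v axis j 1) $ i"
        by (simp add: matrix_vector_mult_def axis_def if_distrib[of "\<lambda>x. _ * x"] cong: if_cong)
      then have "cmod (A $ i $ j) \<le> c * N (A *v axis j 1)"
        using c(2)[of "A *v axis j 1"] Finite_Cartesian_Product.norm_nth_le[of "A *v axis j 1" i] by simp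
      also have "\<dots> \<le> c * N (axis j 1)"
        using A c(1) by (simp add: contractive_def)
      finally show ?thesis .
    qed
    then show "norm A \<le> (\<Sum>i\<in>(UNIV :: 'n set). \<Sum>j\<in>UNIV. c * N (axis j 1))"
      by (intro order_trans[OF norm_matrix_le] sum_mono)
  qed
qed

lemma M_E_eigenvector:
  assumes "contractive A" "A \<in> M_E N \<psi>" "\<psi> \<noteq> 0"
  shows "A *v v = z *s v \<Longrightarrow> cmod z = 1 \<Longrightarrow> v \<noteq> 0 \<Longrightarrow> z = 1 \<and> (\<exists>c. v = c *s \<psi>)"
proof -
  assume v: "A *v v = z *s v" "cmod z = 1" "v \<noteq> 0"
  then have "z \<in> spectrum A \<inter> sphere 0 1" using mem_spectrum_iff by auto
  moreover have "spectrum A \<inter> sphere 0 1 = {1}" using assms(2) by (simp add: M_E_def)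
  ultimately have z: "z = 1" by blast
  have *: "order 1 (charpoly A) = 1" "A *v \<psi> = 1 *s \<psi>"
    using assms(2) by (simp_all add: M_E_def simple_eigenvalue_def)
  have "\<exists>c. v = c *s \<psi>"
    using simple_eigenvalue_iff[OF *(2) assms(3) contractive_charpoly[OF assms(1)]] *(1) v(1) z by blast
  with z show ?thesis by blast
qed

context
  fixes A \<psi>
  assumes A: "contractive A" "A *v \<psi> = \<psi>" "norm \<psi> = 1"
begin

lemma cinner_psi: "cinner (psi \<psi> A) v = cinner \<psi> (riesz_projection A 1 *v v)"
  by (simp add: psi_def cinner_cadjoint)

lemma cinner_psi_fixed: "cinner (psi \<psi> A) \<psi> = 1"
  using A riesz_projection_fixed[OF A(1,2)] by (simp add: cinner_psi cinner_self)

lemma cinner_psi_invariant: "cinner (psi \<psi> A) (A *v v) = cinner (psi \<psi> A) v"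
  by (simp add: cinner_psi riesz_projection_right[OF A(1)])

text \<open>\<psi> is a right and \<open>psi \<psi> A\<close> a left fixed vector of
  \<open>A\<close>, so the rank-one projection absorbs \<open>A\<close> on both sides. The mean of
  \<open>M_Q\<close> thereby becomes linear in the means of \<open>M\<close> and
  \<open>psi\<close>.\<close>

lemma M_Q_eq: "M_Q \<psi> A = A - ketbra \<psi> (psi \<psi> A)"
proof -
  have Q: "Q_of \<psi> A *v v = v - cinner (psi \<psi> A) v *s \<psi>" for v
    by (simp add: Q_of_def P_of_def matrix_vector_mult_diff_rdistrib ketbra_vector_mult)
  have "M_Q \<psi> A *v v = A *v v - cinner (psi \<psi> A) v *s \<psi>" for v
    by (simp add: M_Q_def matrix_vector_mul_assoc[symmetric] Q matrix_vector_mult_diff_distrib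
        matrix_vector_mult_smult A(2) cinner_diff_right cinner_smult_right cinner_psi_fixed cinner_psi_invariant)
  then show ?thesis
    by (simp add: matrix_eq matrix_vector_mult_diff_rdistrib ketbra_vector_mult)
qed

end

end

section \<open>First moments of \<open>M\<close> and of the random vector \<open>psi\<close>\<close>

context RRDO
begin

sublocale complex_norm N
  using norm_N by (rule complex_norm.intro)

definition EM where "EM = (\<integral>\<omega>. M \<omega> \<partial>p)"

lemma contractive_M: "\<omega> \<in> space p \<Longrightarrow> contractive (M \<omega>)"
  using contraction by (simp add: contractive_def)

lemma integrable_M: "integrable p M"
proof -
  obtain C where "\<And>A. contractive A \<Longrightarrow> norm A \<le> C" using contractive_bounded by blast
  then have "AE \<omega> in p. norm (M \<omega>) \<le> C" using contractive_M by (intro AE_I2) auto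
  then show ?thesis using measurable_M by (rule integrable_const_bound)
qed

lemma integrable_M_vector: "integrable p (\<lambda>\<omega>. M \<omega> *v v)"
  by (rule integrable_bounded_linear[OF bounded_linear_matrix_vector_mult integrable_M])

lemma EM_vector_mult: "EM *v v = (\<integral>\<omega>. M \<omega> *v v \<partial>p)"
  unfolding EM_def
  by (rule integral_bounded_linear[OF bounded_linear_matrix_vector_mult integrable_M, symmetric])

lemma contractive_EM: "contractive EM"
  unfolding contractive_def EM_vector_mult
  by (intro allI N_integral_le integrable_M_vector AE_I2 contraction) (simp_all add: prob_space_axioms)

lemma EM_fixed: "EM *v \<psi>S = \<psi>S"
proof -
  have "(\<integral>\<omega>. M \<omega> *v \<psi>S \<partial>p) = (\<integral>\<omega>. \<psi>S \<partial>p)" by (intro Bochner_Integration.integral_cong invariant refl)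
  then show ?thesis by (simp add: EM_vector_mult prob_space)
qed

lemma \<psi>S_nonzero: "\<psi>S \<noteq> 0"
  using normalized by auto

text \<open>The contour radius is an arbitrary choice for each matrix, so the definition does not
  show measurability; the Cesaro means are continuous in the matrix.\<close>

lemma measurable_riesz_projection: "(\<lambda>\<omega>. riesz_projection (M \<omega>) 1) \<in> borel_measurable p"
proof (rule borel_measurable_LIMSEQ_metric)
  show "(\<lambda>\<omega>. cesaro (M \<omega>) K) \<in> borel_measurable p" for K
    using measurable_M by (intro borel_measurable_continuous_on[OF continuous_on_cesaro])
  show "(\<lambda>K. cesaro (M \<omega>) K) \<longlonglongrightarrow> riesz_projection (M \<omega>) 1" if "\<omega> \<in> space p" for \<omega>
    by (intro cesaro_tendsto_riesz_projection contractive_M that)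
qed

lemma measurable_psi: "(\<lambda>\<omega>. psi \<psi>S (M \<omega>)) \<in> borel_measurable p"
  unfolding psi_def
  by (rule borel_measurable_continuous_on[OF _ measurable_riesz_projection]) (intro continuous_intros)

text \<open>The bound is in the dual norm of \<open>N\<close>: adjoints of the contractions
  \<open>M \<omega>\<close> do not increase it, whereas they may increase the Euclidean norm. It
  therefore propagates along \<open>theta\<close>.\<close>

lemma psi_bounded:
  obtains K where "K \<ge> 0" "\<And>\<omega> v. \<omega> \<in> space p \<Longrightarrow> cmod (cinner (psi \<psi>S (M \<omega>)) v) \<le> K * N v"
proof -
  obtain c where c: "c > 0" "\<And>v. norm v \<le> c * N v" using N_lower by blast
  obtain B where B: "B > 0" "\<And>x. norm (cinner \<psi>S x) \<le> norm x * B"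
    using bounded_linear.pos_bounded[OF bounded_linear_cinner_right] by blast
  show thesis
  proof (rule that[of "B * c"])
    fix \<omega> v assume \<omega>: "\<omega> \<in> space p"
    let ?E = "riesz_projection (M \<omega>) 1"
    have "N (?E *v v) \<le> N v"
      using contractive_riesz_projection[OF contractive_M[OF \<omega>]] by (simp add: contractive_def)
    then have "norm (?E *v v) \<le> c * N v"
      using c by (meson mult_left_mono less_imp_le order_trans)
    then have "norm (?E *v v) * B \<le> c * N v * B"
      using B(1) by (intro mult_right_mono) auto
    then show "cmod (cinner (psi \<psi>S (M \<omega>)) v) \<le> B * c * N v"
      using B(2)[of "?E *v v"] cinner_psi[OF contractive_M[OF \<omega>] invariant[OF \<omega>] normalized]
      by (simp add: mult_ac)
  qed (use B c in simp)
qed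

lemma norm_le_of_functional_bound:
  assumes "K \<ge> 0" "\<And>v. cmod (cinner x v) \<le> K * N v"
  shows "norm x \<le> (\<Sum>i\<in>UNIV. K * N (axis i 1))"
proof -
  have "norm x \<le> (\<Sum>i\<in>UNIV. norm (x $ i))"
    unfolding norm_vec_def by (rule L2_set_le_sum) simp
  also have "\<dots> \<le> (\<Sum>i\<in>UNIV. K * N (axis i 1))"
    using assms(2)[of "axis _ 1"] by (intro sum_mono) simp
  finally show ?thesis .
qed

lemma integrable_psi: "integrable p (\<lambda>\<omega>. psi \<psi>S (M \<omega>))"
proof -
  obtain K where "K \<ge> 0" "\<And>\<omega> v. \<omega> \<in> space p \<Longrightarrow> cmod (cinner (psi \<psi>S (M \<omega>)) v) \<le> K * N v"
    using psi_bounded by blast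
  then have "AE \<omega> in p. norm (psi \<psi>S (M \<omega>)) \<le> (\<Sum>i\<in>UNIV. K * N (axis i 1))"
    by (intro AE_I2 norm_le_of_functional_bound) auto
  then show ?thesis using measurable_psi by (rule integrable_const_bound)
qed

definition Epsi where "Epsi = (\<integral>\<omega>. psi \<psi>S (M \<omega>) \<partial>p)"

lemma cinner_Epsi: "cinner Epsi \<psi>S = 1"
proof -
  have "cinner Epsi \<psi>S = (\<integral>\<omega>. cinner (psi \<psi>S (M \<omega>)) \<psi>S \<partial>p)"
    unfolding Epsi_def
    by (rule integral_bounded_linear[OF bounded_linear_cinner_left integrable_psi, symmetric])
  also have "\<dots> = (\<integral>\<omega>. 1 \<partial>p)"
    by (intro Bochner_Integration.integral_cong cinner_psi_fixed contractive_M invariant normalized refl)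
  finally show ?thesis by (simp add: prob_space)
qed

lemma EM_Q_eq: "(\<integral>\<omega>. M_Q \<psi>S (M \<omega>) \<partial>p) = EM - ketbra \<psi>S Epsi"
proof -
  have "(\<integral>\<omega>. M_Q \<psi>S (M \<omega>) \<partial>p) = (\<integral>\<omega>. M \<omega> - ketbra \<psi>S (psi \<psi>S (M \<omega>)) \<partial>p)"
    by (intro Bochner_Integration.integral_cong M_Q_eq contractive_M invariant normalized refl)
  also have "\<dots> = EM - (\<integral>\<omega>. ketbra \<psi>S (psi \<psi>S (M \<omega>)) \<partial>p)"
    unfolding EM_def
    by (intro Bochner_Integration.integral_diff integrable_M integrable_bounded_linear[OF bounded_linear_ketbra integrable_psi])
  also have "(\<integral>\<omega>. ketbra \<psi>S (psi \<psi>S (M \<omega>)) \<partial>p) = ketbra \<psi>S Epsi"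
    unfolding Epsi_def by (rule integral_bounded_linear[OF bounded_linear_ketbra integrable_psi])
  finally show ?thesis .
qed

end

section \<open>The spectrum of the mean operator\<close>

locale ergodic_RRDO = RRDO +
  assumes positive: "measure p {\<omega> \<in> space p. M \<omega> \<in> M_E N \<psi>S} > 0"
begin

text \<open>All values of \<open>M\<close> are contractive, so intersecting \<open>M_E\<close> with
  the contractive matrices leaves the event unchanged and provides a contractive
  \<open>A\<close>.\<close>

lemma M_E_support_point:
  obtains A where "A \<in> M_E N \<psi>S" "contractive A"
    "\<And>e. 0 < e \<Longrightarrow> 0 < measure p {\<omega> \<in> space p. M \<omega> \<in> ball A e}"
proof -
  have "{\<omega> \<in> space p. M \<omega> \<in> M_E N \<psi>S} = {\<omega> \<in> space p. M \<omega> \<in> M_E N \<psi>S \<inter> Collect contractive}"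
    using contractive_M by auto
  then show thesis
    using support_point[OF measurable_M, of "M_E N \<psi>S \<inter> Collect contractive"] positive that by auto
qed

text \<open>
  A functional that attains its norm at \<open>w\<close> and satisfies \<open>g \<circ> EM = z g\<close> satisfies
  \<open>g (M \<omega> x) = z g x\<close> almost surely at every extremal \<open>x\<close>, since a mean of numbers in a disc lies on
  the circle only if they agree. This passes to support points \<open>A\<close> of the law of \<open>M\<close>, and the
  ergodic projection of \<open>A / z\<close> turns \<open>w\<close> into an eigenvector of \<open>A\<close> for \<open>z\<close>.
\<close>

lemma left_eigenvector_eq_0:
  assumes z: "cmod z = 1" and inv: "\<And>v. cinner g (EM *v v) = z * cinner g v" and g0: "cinner g \<psi>S = 0"
  shows "g = 0"
proof (rule ccontr)
  assume "g \<noteq> 0"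
  obtain A where A: "A \<in> M_E N \<psi>S" "contractive A"
    "\<And>e. 0 < e \<Longrightarrow> 0 < measure p {\<omega> \<in> space p. M \<omega> \<in> ball A e}"
    using M_E_support_point by blast
  obtain c where c: "c > 0" "\<And>v. norm v \<le> c * N v" using N_lower by blast
  let ?B = "{v. N v \<le> 1}"
  have "closed ?B" using N_continuous by (intro closed_Collect_le continuous_intros)
  moreover have "norm v \<le> c" if "v \<in> ?B" for v
  proof -
    have "c * N v \<le> c * 1" using c(1) that by (intro mult_left_mono) auto
    then show ?thesis using c(2)[of v] by linarith
  qed
  ultimately have "compact ?B" by (auto simp: compact_eq_bounded_closed bounded_iff)
  moreover have "?B \<noteq> {}" by (auto intro!: exI[of _ 0] simp: N_eq_0[THEN iffD2])
  moreover have "continuous_on ?B (\<lambda>v. cmod (cinner g v))" by (intro continuous_intros)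
  ultimately obtain w where w: "N w \<le> 1" "\<And>v. N v \<le> 1 \<Longrightarrow> cmod (cinner g v) \<le> cmod (cinner g w)"
    using continuous_attains_sup[of ?B "\<lambda>v. cmod (cinner g v)"] by auto
  define G where "G = cmod (cinner g w)"
  have "N g > 0" using \<open>g \<noteq> 0\<close> by (metis N_eq_0 N_nonneg less_eq_real_def)
  then have "0 < cmod (cinner g ((1 / N g) *\<^sub>R g))"
    using \<open>g \<noteq> 0\<close> by (simp add: scaleR_eq_vector_smult cinner_smult_right cinner_self)
  also have "\<dots> \<le> G" unfolding G_def using \<open>N g > 0\<close> by (intro w(2)) (simp add: N_scaleR)
  finally have G: "G > 0" .
  have step: "cinner g (A *v x) = z * cinner g x" if x: "N x \<le> 1" "cmod (cinner g x) = G" for x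
  proof -
    define u where "u = z * cinner g x"
    have u: "cmod u = G" by (simp add: u_def norm_mult z x(2))
    \<comment> \<open>Multiplication by \<open>cnj u\<close> rotates the target to the positive
      reals: the mean of \<open>h\<close> is \<open>G\<^sup>2\<close>, while its modulus is at most
      \<open>G\<^sup>2\<close>. Hence almost surely the real part is \<open>G\<^sup>2\<close> and
      the imaginary part 0.\<close>
    define h where "h \<omega> = cnj u * cinner g (M \<omega> *v x)" for \<omega>
    have int: "integrable p h"
      unfolding h_def
      by (intro integrable_mult_right integrable_bounded_linear[OF bounded_linear_cinner_right integrable_M_vector])
    have "(\<integral>\<omega>. h \<omega> \<partial>p) = cnj u * cinner g (EM *v x)"
      unfolding h_def EM_vector_mult
      by (simp add: integral_bounded_linear[OF bounded_linear_cinner_right integrable_M_vector])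
    also have "\<dots> = of_real (G\<^sup>2)"
      unfolding inv u_def[symmetric] u[symmetric] by (metis complex_norm_square mult.commute)
    finally have "Re (\<integral>\<omega>. h \<omega> \<partial>p) = G\<^sup>2" by simp
    then have "(\<integral>\<omega>. G\<^sup>2 - Re (h \<omega>) \<partial>p) = 0"
      using int by (simp add: prob_space)
    moreover have hle: "cmod (h \<omega>) \<le> G\<^sup>2" if "\<omega> \<in> space p" for \<omega>
    proof -
      have "N (M \<omega> *v x) \<le> 1" using contraction[OF that, of x] x(1) by simp
      then have "cmod (cinner g (M \<omega> *v x)) \<le> G" unfolding G_def by (rule w(2))
      then show ?thesis using G by (simp add: h_def norm_mult u power2_eq_square)
    qed
    moreover have "AE \<omega> in p. 0 \<le> G\<^sup>2 - Re (h \<omega>)"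
      using hle complex_Re_le_cmod by (intro AE_I2) (simp, meson order_trans)
    moreover have "integrable p (\<lambda>\<omega>. G\<^sup>2 - Re (h \<omega>))" using int by simp
    ultimately have "AE \<omega> in p. G\<^sup>2 - Re (h \<omega>) = 0"
      using integral_nonneg_eq_0_iff_AE by blast
    then have AE: "AE \<omega> in p. cinner g (M \<omega> *v x) = u"
    proof (rule AE_mp, intro AE_I2 impI)
      fix \<omega> assume \<omega>: "\<omega> \<in> space p" "G\<^sup>2 - Re (h \<omega>) = 0"
      have "(cmod (h \<omega>))\<^sup>2 \<le> (Re (h \<omega>))\<^sup>2"
        using hle[OF \<omega>(1)] \<omega>(2) by (intro power_mono) auto
      then have "Im (h \<omega>) = 0" by (simp add: cmod_power2)
      then have "h \<omega> = cnj u * u"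
        using \<omega>(2) u by (simp add: complex_eq_iff mult.commute[of "cnj u"] flip: complex_norm_square)
      then show "cinner g (M \<omega> *v x) = u" using G u by (auto simp: h_def)
    qed
    show ?thesis
    proof (rule ccontr)
      assume neq: "cinner g (A *v x) \<noteq> z * cinner g x"
      \<comment> \<open>A failure at \<open>A\<close> would persist on a ball around
        \<open>A\<close>, which \<open>M\<close> hits with positive probability.\<close>
      have "open {B. cinner g (B *v x) \<noteq> u}"
        by (intro open_Collect_neq continuous_intros)
      then obtain e where e: "e > 0" "ball A e \<subseteq> {B. cinner g (B *v x) \<noteq> u}"
        using neq by (auto simp: open_contains_ball u_def)
      have "AE \<omega> in p. M \<omega> \<notin> ball A e" using AE by (rule eventually_mono) (use e(2) in blast)
      then have "measure p {\<omega> \<in> space p. M \<omega> \<in> ball A e} = 0"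
        using measurable_M by (subst (asm) AE_iff_measurable[OF _ refl]) (auto simp: measure_def)
      then show False using A(3)[OF e(1)] by simp
    qed
  qed
  define A' where "A' = mat (1 / z) ** A"
  have A': "A' *v v = (1 / z) *s (A *v v)" for v
    by (simp add: A'_def mat_vector_mult flip: matrix_vector_mul_assoc)
  have cA': "contractive A'"
    using A(2) by (simp add: contractive_def A' N_smult norm_divide z)
  \<comment> \<open>Dividing by \<open>z\<close> cancels the factor from \<open>step\<close>, so all
    iterates of \<open>w\<close> stay in the unit ball with the same, extremal value of the
    functional.\<close>
  have pow: "N (matrix_power A' k *v w) \<le> 1 \<and> cinner g (matrix_power A' k *v w) = cinner g w" for k
  proof (induction k)
    case 0
    then show ?case by (simp add: w(1))
  next
    case (Suc k)
    have "N (matrix_power A' (Suc k) *v w) \<le> 1"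
      using contractive_power[OF cA', of "Suc k" w] w(1) by linarith
    moreover have "z \<noteq> 0" using z by auto
    ultimately show ?case
      using step[of "matrix_power A' k *v w"] Suc
      by (simp add: matrix_power_Suc A' cinner_smult_right G_def)
  qed
  let ?E = "riesz_projection A' 1"
  have "cinner g (cesaro A' K *v w) = cinner g w" if "K > 0" for K
    using that linear_sum[OF bounded_linear.linear[OF bounded_linear_cinner_right], of g "\<lambda>k. matrix_power A' k *v w" "{..<K}"]
    by (simp add: cesaro_vector_mult scaleR_eq_vector_smult cinner_smult_right pow)
  then have "(\<lambda>K. cinner g (cesaro A' K *v w)) \<longlonglongrightarrow> cinner g w"
    by (intro tendsto_eventually) (auto simp: eventually_at_top_dense intro!: exI[of _ 0])
  then have gE: "cinner g (?E *v w) = cinner g w"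
    by (rule LIMSEQ_unique[OF tendsto_cinner[OF tendsto_const tendsto_matrix_vector_mult[OF cesaro_tendsto_riesz_projection[OF cA'] tendsto_const]]])
  then have nz: "?E *v w \<noteq> 0" using G by (auto simp: G_def)
  have "A *v (?E *v w) = z *s ((1 / z) *s (A *v (?E *v w)))"
    using z by (auto simp: vector_smult_assoc)
  then have "A *v (?E *v w) = z *s (?E *v w)" using riesz_projection_left[OF cA', of w] by (simp only: A')
  then obtain k where "?E *v w = k *s \<psi>S"
    using M_E_eigenvector[OF A(2,1) \<psi>S_nonzero _ z nz] by blast
  then show False using gE g0 G by (simp add: G_def cinner_smult_right)
qed

text \<open>Each coordinate functional of the projection is invariant under \<open>EM\<close>.
  Subtracting the multiple of \<open>psi \<psi>S EM\<close> that makes it vanish at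
  \<open>\<psi>S\<close> leaves a functional excluded by \<open>left_eigenvector_eq_0\<close> with
  \<open>z = 1\<close>.\<close>

lemma EM_projection: "riesz_projection EM 1 *v v = cinner (psi \<psi>S EM) v *s \<psi>S"
proof -
  let ?E = "riesz_projection EM 1"
  have "(?E *v v) $ i = cinner (psi \<psi>S EM) v * \<psi>S $ i" for i
  proof -
    define g where "g = cadjoint ?E *v axis i 1 - cnj (\<psi>S $ i) *s psi \<psi>S EM"
    have g: "cinner g v = (?E *v v) $ i - \<psi>S $ i * cinner (psi \<psi>S EM) v" for v
      by (simp add: g_def cinner_diff_left cinner_cadjoint cinner_smult_left)
    have "g = 0"
    proof (rule left_eigenvector_eq_0[of 1])
      show "cinner g \<psi>S = 0"
        using riesz_projection_fixed[OF contractive_EM EM_fixed]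
        by (simp add: g cinner_psi_fixed[OF contractive_EM EM_fixed normalized])
      show "cinner g (EM *v v) = 1 * cinner g v" for v
        by (simp add: g riesz_projection_right[OF contractive_EM] cinner_psi_invariant[OF contractive_EM EM_fixed normalized])
    qed simp
    then show ?thesis using g[of v] by simp
  qed
  then show ?thesis by (simp add: vec_eq_iff)
qed

lemma EM_in_M_E: "EM \<in> M_E N \<psi>S"
proof -
  have "N (EM *v v) / N v \<le> 1" for v
    using contractive_EM by (cases "N v = 0") (auto simp: contractive_def field_simps less_le)
  then have "induced_norm N EM \<le> 1"
    unfolding induced_norm_def by (intro cSUP_least) auto
  moreover have one: "1 \<in> spectrum EM"
    using EM_fixed \<psi>S_nonzero by (auto simp: mem_spectrum_iff)
  moreover have "z = 1" if z: "z \<in> spectrum EM" "cmod z = 1" for z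
  proof (rule ccontr)
    assume "z \<noteq> 1"
    obtain g where g: "g \<noteq> 0" "\<And>v. cinner g (EM *v v) = z * cinner g v"
      using mem_spectrum_left_eigenvector[OF z(1)] by blast
    \<comment> \<open>Evaluation at the fixed vector \<open>\<psi>S\<close> gives
      \<open>cinner g \<psi>S = z * cinner g \<psi>S\<close>.\<close>
    have "cinner g \<psi>S = 0" using g(2)[of \<psi>S] \<open>z \<noteq> 1\<close> by (simp add: EM_fixed)
    then show False using left_eigenvector_eq_0[OF z(2) g(2)] g(1) by blast
  qed
  moreover have "order 1 (charpoly EM) = 1"
  proof (subst simple_eigenvalue_iff[OF _ \<psi>S_nonzero contractive_charpoly[OF contractive_EM]])
    show "(\<forall>v. EM *v v = 1 *s v \<longrightarrow> (\<exists>c. v = c *s \<psi>S)) \<and> (\<nexists>v. 1 *s v - EM *v v = \<psi>S)"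
    proof (intro conjI allI impI notI)
      fix v assume "EM *v v = 1 *s v"
      then show "\<exists>c. v = c *s \<psi>S"
        using riesz_projection_fixed[OF contractive_EM, of v] EM_projection[of v] by (metis vector_smult_lid)
    next
      assume "\<exists>v. 1 *s v - EM *v v = \<psi>S"
      then obtain v where "v - EM *v v = \<psi>S" by auto
      \<comment> \<open>The projection kills coboundaries but fixes \<open>\<psi>S\<close>.\<close>
      then have "riesz_projection EM 1 *v \<psi>S = 0"
        by (metis matrix_vector_mult_diff_distrib riesz_projection_right[OF contractive_EM] diff_self)
      then show False
        using riesz_projection_fixed[OF contractive_EM EM_fixed] \<psi>S_nonzero by simp
    qed
  qed (simp add: EM_fixed)
  ultimately show ?thesis
    by (auto simp: M_E_def simple_eigenvalue_def EM_fixed)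
qed

definition one_minus_EMQ_adjoint where "one_minus_EMQ_adjoint = mat 1 - cadjoint (EM - ketbra \<psi>S Epsi)"

lemma one_minus_EMQ_adjoint_vector_mult: "one_minus_EMQ_adjoint *v v = v - cadjoint EM *v v + cinner \<psi>S v *s Epsi"
  by (simp add: one_minus_EMQ_adjoint_def cadjoint_diff matrix_vector_mult_diff_rdistrib cadjoint_ketbra_vector_mult)

text \<open>Pairing a kernel vector \<open>g\<close> with \<open>\<psi>S\<close> cancels the first
  two terms, as \<open>EM\<close> fixes \<open>\<psi>S\<close>, and leaves
  \<open>cinner g \<psi>S = 0\<close>. The rank-one term then drops out, and \<open>g\<close> is a
  left fixed vector of \<open>EM\<close>.\<close>

lemma one_minus_EMQ_adjoint_invertible: "invertible one_minus_EMQ_adjoint"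
  unfolding invertible_iff_kernel
proof (intro allI impI)
  fix g assume "one_minus_EMQ_adjoint *v g = 0"
  then have eq: "g - cadjoint EM *v g + cinner \<psi>S g *s Epsi = 0" by (simp add: one_minus_EMQ_adjoint_vector_mult)
  have "0 = cinner (g - cadjoint EM *v g + cinner \<psi>S g *s Epsi) \<psi>S" by (simp add: eq)
  also have "\<dots> = cinner g \<psi>S"
    by (simp add: cinner_add_left cinner_diff_left cinner_cadjoint EM_fixed cinner_smult_left cinner_Epsi
        flip: cinner_commute)
  finally have g0: "cinner g \<psi>S = 0" by simp
  then have "cinner \<psi>S g = 0" using cinner_commute[of \<psi>S g] by simp
  then have "cadjoint EM *v g = g" using eq by simp
  then have "cinner g (EM *v v) = 1 * cinner g v" for v by (simp flip: cinner_cadjoint)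
  then show "g = 0" using left_eigenvector_eq_0[of 1 g] g0 by simp
qed

text \<open>The fixed vector of \<open>cadjoint EM\<close>, normalized against
  \<open>\<psi>S\<close>, solves the limit equation. With invertibility this evaluates the inverse
  on \<open>Epsi\<close>.\<close>

lemma one_minus_EMQ_adjoint_psi: "one_minus_EMQ_adjoint *v psi \<psi>S EM = Epsi"
proof -
  have "cadjoint EM *v psi \<psi>S EM = psi \<psi>S EM"
    by (rule cinner_ext) (simp add: cinner_cadjoint cinner_psi_invariant[OF contractive_EM EM_fixed normalized])
  moreover have "cinner \<psi>S (psi \<psi>S EM) = 1"
    by (subst cinner_commute) (simp add: cinner_psi_fixed[OF contractive_EM EM_fixed normalized])
  ultimately show ?thesis by (simp add: one_minus_EMQ_adjoint_vector_mult)
qed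

text \<open>The adjoint projection has rank one and sees only the component along
  \<open>\<psi>S\<close>; this is why \<open>Epsi\<close> and \<open>\<psi>S\<close> have the same
  image.\<close>

lemma cadjoint_EM_projection: "cinner \<psi>S v = 1 \<Longrightarrow> cadjoint (riesz_projection EM 1) *v v = psi \<psi>S EM"
proof -
  assume v: "cinner \<psi>S v = 1"
  have "riesz_projection EM 1 = ketbra \<psi>S (psi \<psi>S EM)"
    by (simp add: matrix_eq EM_projection ketbra_vector_mult)
  then show ?thesis by (simp add: cadjoint_ketbra_vector_mult v)
qed

end

subsection \<open>Almost sure convergence of the averages\<close>

text \<open>With \<open>m = floor_sqrt K\<close> one has \<open>K - m\<^sup>2 \<le> 2 * m\<close>,
  so \<open>S\<close> moves by at most \<open>2 * m * C\<close> after the last square; division by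
  \<open>K \<ge> m\<^sup>2\<close> leaves \<open>2 * C / m\<close>.\<close>

lemma average_tendsto_0_of_squares:
  fixes S :: "nat \<Rightarrow> 'a::real_normed_vector"
  assumes step: "\<And>n. norm (S (Suc n) - S n) \<le> C"
    and sq: "(\<lambda>k. (1 / real (k\<^sup>2)) *\<^sub>R S (k\<^sup>2)) \<longlonglongrightarrow> 0"
  shows "(\<lambda>K. (1 / real K) *\<^sub>R S K) \<longlonglongrightarrow> 0"
proof (rule Lim_null_comparison)
  have C: "C \<ge> 0" using step[of 0] norm_ge_zero order_trans by blast
  have diff: "norm (S (m + k) - S m) \<le> real k * C" for m k
  proof (induction k)
    case (Suc k)
    have "norm (S (m + Suc k) - S m) \<le> norm (S (Suc (m + k)) - S (m + k)) + norm (S (m + k) - S m)"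
      using norm_triangle_ineq[of "S (Suc (m + k)) - S (m + k)" "S (m + k) - S m"] by simp
    then show ?case using Suc step[of "m + k"] by (simp add: distrib_right)
  qed simp
  have lim: "filterlim floor_sqrt at_top sequentially"
    unfolding filterlim_at_top eventually_at_top_linorder by (metis le_floor_sqrt_iff)
  have "(\<lambda>K. norm ((1 / real ((floor_sqrt K)\<^sup>2)) *\<^sub>R S ((floor_sqrt K)\<^sup>2)) + 2 * C / real (floor_sqrt K)) \<longlonglongrightarrow> 0 + 0"
    using sq lim by (intro tendsto_add filterlim_compose[OF _ lim] tendsto_norm_zero lim_const_over_n)
  then show "(\<lambda>K. norm ((1 / real ((floor_sqrt K)\<^sup>2)) *\<^sub>R S ((floor_sqrt K)\<^sup>2)) + 2 * C / real (floor_sqrt K)) \<longlonglongrightarrow> 0"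
    by simp
  show "\<forall>\<^sub>F K in sequentially. norm ((1 / real K) *\<^sub>R S K)
    \<le> norm ((1 / real ((floor_sqrt K)\<^sup>2)) *\<^sub>R S ((floor_sqrt K)\<^sup>2)) + 2 * C / real (floor_sqrt K)"
  proof (rule eventually_mono[OF eventually_gt_at_top[of 0]])
    fix K :: nat assume "K > 0"
    define m where "m = floor_sqrt K"
    have m: "m\<^sup>2 \<le> K" "K < (Suc m)\<^sup>2" "m > 0"
      using \<open>K > 0\<close> Suc_floor_sqrt_power2_gt[of K] by (auto simp: m_def)
    then have "K - m\<^sup>2 \<le> 2 * m" by (simp add: power2_eq_square)
    then have "real (K - m\<^sup>2) * C \<le> real (2 * m) * C" using C by (intro mult_right_mono) auto
    then have "norm (S K - S (m\<^sup>2)) \<le> 2 * real m * C"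
      using diff[of "m\<^sup>2" "K - m\<^sup>2"] m(1) by simp
    then have "norm (S K) \<le> norm (S (m\<^sup>2)) + 2 * real m * C"
      using norm_triangle_ineq2[of "S K" "S (m\<^sup>2)"] by simp
    then have "norm (S K) / real K \<le> (norm (S (m\<^sup>2)) + 2 * real m * C) / real (m\<^sup>2)"
      using m C \<open>K > 0\<close> by (intro frac_le) auto
    also have "\<dots> = norm (S (m\<^sup>2)) / real (m\<^sup>2) + 2 * C / real m"
      using m(3) by (simp add: add_divide_distrib power2_eq_square)
    finally show "norm ((1 / real K) *\<^sub>R S K)
      \<le> norm ((1 / real ((floor_sqrt K)\<^sup>2)) *\<^sub>R S ((floor_sqrt K)\<^sup>2)) + 2 * C / real (floor_sqrt K)"
      by (simp add: m_def)
  qed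
qed

text \<open>
  The second moment of the averages is \<open>O(1/K)\<close>, hence summable along squares; boundedness
  controls the averages in between.
\<close>

lemma (in prob_space) bounded_orthogonal_strong_law:
  fixes X :: "nat \<Rightarrow> 'a \<Rightarrow> 'b::euclidean_space"
  assumes meas [measurable]: "\<And>n. X n \<in> borel_measurable M"
    and bound: "\<And>n \<omega>. \<omega> \<in> space M \<Longrightarrow> norm (X n \<omega>) \<le> C"
    and orth: "\<And>i j. i < j \<Longrightarrow> expectation (\<lambda>\<omega>. X i \<omega> \<bullet> X j \<omega>) = 0"
  shows "AE \<omega> in M. (\<lambda>K. (1 / real K) *\<^sub>R (\<Sum>n<K. X n \<omega>)) \<longlonglongrightarrow> 0"
proof -
  define S where "S K \<omega> = (\<Sum>n<K. X n \<omega>)" for K \<omega>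
  have S [measurable]: "S K \<in> borel_measurable M" for K
    unfolding S_def by measurable
  have C: "C \<ge> 0" using bound norm_ge_zero order_trans not_empty by blast
  have Sb: "norm (S K \<omega>) \<le> real K * C" if "\<omega> \<in> space M" for K \<omega>
    using sum_norm_bound[of "{..<K}" "\<lambda>n. X n \<omega>" C] bound[OF that] by (simp add: S_def)
  have intX: "integrable M (\<lambda>\<omega>. X i \<omega> \<bullet> X j \<omega>)" for i j
  proof (rule integrable_const_bound[of _ "C * C"])
    show "AE \<omega> in M. norm (X i \<omega> \<bullet> X j \<omega>) \<le> C * C"
      using bound C unfolding real_norm_def
      by (intro AE_I2 order_trans[OF Cauchy_Schwarz_ineq2] mult_mono) auto
  qed measurable
  have intS: "integrable M (\<lambda>\<omega>. (norm (S K \<omega>))\<^sup>2)" for K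
  proof (rule integrable_const_bound[of _ "(real K * C)\<^sup>2"])
    show "AE \<omega> in M. norm ((norm (S K \<omega>))\<^sup>2) \<le> (real K * C)\<^sup>2"
      using Sb by (intro AE_I2) (simp add: power_mono)
  qed measurable
  have var: "expectation (\<lambda>\<omega>. (norm (S K \<omega>))\<^sup>2) \<le> real K * C\<^sup>2" for K
  proof (induction K)
    case (Suc K)
    have "expectation (\<lambda>\<omega>. (norm (S (Suc K) \<omega>))\<^sup>2) =
      expectation (\<lambda>\<omega>. (norm (S K \<omega>))\<^sup>2 + 2 * (\<Sum>i<K. X i \<omega> \<bullet> X K \<omega>) + X K \<omega> \<bullet> X K \<omega>)"
      by (simp add: S_def power2_norm_eq_inner inner_add_left inner_add_right inner_commute[of "X K _" "sum _ _"] inner_sum_left algebra_simps)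
    also have "\<dots> = expectation (\<lambda>\<omega>. (norm (S K \<omega>))\<^sup>2) + expectation (\<lambda>\<omega>. X K \<omega> \<bullet> X K \<omega>)"
      using intX intS by (simp add: orth)
    also have "expectation (\<lambda>\<omega>. X K \<omega> \<bullet> X K \<omega>) \<le> C\<^sup>2"
      using bound intX[of K K] by (intro integral_le_const AE_I2) (simp_all add: power_mono flip: power2_norm_eq_inner)
    finally show ?case using Suc by (simp add: distrib_right)
  qed (simp add: S_def)
  define Y where "Y k \<omega> = (norm ((1 / real (k\<^sup>2)) *\<^sub>R S (k\<^sup>2) \<omega>))\<^sup>2" for k \<omega>
  have Y [measurable]: "Y k \<in> borel_measurable M" for k unfolding Y_def by measurable
  have Yeq: "Y k \<omega> = (1 / real (k\<^sup>2))\<^sup>2 * (norm (S (k\<^sup>2) \<omega>))\<^sup>2" for k \<omega>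
    by (simp add: Y_def power_mult_distrib power_divide)
  have Y_nonneg: "0 \<le> Y k \<omega>" for k \<omega> by (simp add: Y_def)
  have intY: "integrable M (Y k)" for k
    unfolding Yeq using intS by simp
  \<comment> \<open>The bound \<open>var\<close> at \<open>k\<^sup>2\<close>, divided by the fourth
    power of \<open>k\<close>. At \<open>k = 0\<close> both sides are 0, since
    \<open>1 / 0 = 0\<close>.\<close>
  have EY: "expectation (Y k) \<le> C\<^sup>2 * (1 / real k ^ 2)" for k
  proof -
    have "expectation (Y k) \<le> (1 / real (k\<^sup>2))\<^sup>2 * (real (k\<^sup>2) * C\<^sup>2)"
      unfolding Yeq using var[of "k\<^sup>2"] by (simp only: integral_mult_right_zero) (intro mult_left_mono, auto)
    then show ?thesis by (cases "k = 0") (simp_all add: power2_eq_square)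
  qed
  have "summable (\<lambda>k. C\<^sup>2 * (1 / real k ^ 2))"
    by (intro summable_mult inverse_power_summable[of 2, unfolded inverse_eq_divide]) simp
  then have "summable (\<lambda>k. expectation (Y k))"
  proof (rule summable_comparison_test'[where N = 0])
    show "norm (expectation (Y k)) \<le> C\<^sup>2 * (1 / real k ^ 2)" for k
      using EY[of k] by (simp add: integral_nonneg Y_nonneg)
  qed
  \<comment> \<open>Interchanging sum and integral turns summable expectations into an almost surely
    finite sum, whose terms must tend to 0.\<close>
  moreover have "(\<integral>\<^sup>+\<omega>. (\<Sum>k. ennreal (Y k \<omega>)) \<partial>M) = (\<Sum>k. ennreal (expectation (Y k)))"
    by (subst nn_integral_suminf) (auto intro!: suminf_cong nn_integral_eq_integral intY simp: Y_nonneg)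
  ultimately have "(\<integral>\<^sup>+\<omega>. (\<Sum>k. ennreal (Y k \<omega>)) \<partial>M) \<noteq> \<infinity>"
    by (simp add: suminf_ennreal2 integral_nonneg Y_nonneg)
  then have "AE \<omega> in M. (\<Sum>k. ennreal (Y k \<omega>)) \<noteq> \<infinity>"
    by (intro nn_integral_noteq_infinite) measurable
  then show ?thesis
  proof (rule AE_mp, intro AE_I2 impI)
    fix \<omega> assume \<omega>: "\<omega> \<in> space M" "(\<Sum>k. ennreal (Y k \<omega>)) \<noteq> \<infinity>"
    have "summable (\<lambda>k. Y k \<omega>)"
      using \<omega>(2) by (intro summable_suminf_not_top) (auto simp: Y_def)
    then have "(\<lambda>k. Y k \<omega>) \<longlonglongrightarrow> 0" by (rule summable_LIMSEQ_zero)
    then have "(\<lambda>k. sqrt (Y k \<omega>)) \<longlonglongrightarrow> sqrt 0" by (rule tendsto_real_sqrt)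
    then have "(\<lambda>k. (1 / real (k\<^sup>2)) *\<^sub>R S (k\<^sup>2) \<omega>) \<longlonglongrightarrow> 0"
      by (simp only: Y_def real_sqrt_abs real_sqrt_zero abs_norm_cancel) (rule tendsto_norm_zero_cancel)
    then show "(\<lambda>K. (1 / real K) *\<^sub>R (\<Sum>n<K. X n \<omega>)) \<longlonglongrightarrow> 0"
      using average_tendsto_0_of_squares[of "\<lambda>K. S K \<omega>" C] bound[OF \<omega>(1)] by (simp add: S_def)
  qed
qed

text \<open>Independence means that the joint law is the product of the marginals. Here the joint
  map is the identity, as points of the product space are extensional.\<close>

lemma (in prob_space) indep_vars_PiM_coordinates:
  assumes "I \<noteq> {}"
  shows "prob_space.indep_vars (PiM I (\<lambda>_. M)) (\<lambda>_. M) (\<lambda>i \<omega>. \<omega> i) I"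
proof -
  interpret P: product_prob_space "\<lambda>_. M" I
    by (simp add: product_prob_space_def product_prob_space_axioms_def product_sigma_finite_def
        prob_space_axioms sigma_finite_measure_axioms)
  have "distr (PiM I (\<lambda>_. M)) (PiM I (\<lambda>_. M)) (\<lambda>x. \<lambda>i\<in>I. x i) = distr (PiM I (\<lambda>_. M)) (PiM I (\<lambda>_. M)) (\<lambda>x. x)"
    by (intro distr_cong) (auto simp: space_PiM PiE_def extensional_restrict)
  also have "\<dots> = (\<Pi>\<^sub>M i\<in>I. distr (PiM I (\<lambda>_. M)) M (\<lambda>\<omega>. \<omega> i))"
    by (simp add: P.PiM_component cong: PiM_cong)
  finally show ?thesis
    using assms by (subst P.P.indep_vars_iff_distr_eq_PiM') auto
qed

text \<open>Invariance of \<open>F\<close> under restriction says that it depends on the first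
  \<open>m\<close> coordinates only. Disjoint blocks of coordinates are independent, so the mean
  factors and the centred \<open>H\<close> annihilates it.\<close>

lemma (in prob_space) PiM_integral_mult_fresh_coordinate:
  fixes F :: "(nat \<Rightarrow> 'a) \<Rightarrow> complex" and H :: "'a \<Rightarrow> complex"
  assumes F: "F \<in> borel_measurable (PiM {1..m} (\<lambda>_. M))" "\<And>\<omega>. F (restrict \<omega> {1..m}) = F \<omega>"
    and int: "integrable (PiM {1..} (\<lambda>_. M)) F" "integrable M H" and zero: "expectation H = 0"
  shows "integrable (PiM {1..} (\<lambda>_. M)) (\<lambda>\<omega>. F \<omega> * H (\<omega> (Suc m)))" (is ?int)
    and "(\<integral>\<omega>. F \<omega> * H (\<omega> (Suc m)) \<partial>PiM {1..} (\<lambda>_. M)) = 0" (is ?zero)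
proof -
  interpret P: product_prob_space "\<lambda>_. M" "{1::nat..}"
    by (simp add: product_prob_space_def product_prob_space_axioms_def product_sigma_finite_def
        prob_space_axioms sigma_finite_measure_axioms)
  let ?PP = "PiM {1::nat..} (\<lambda>_. M)"
  have H: "H \<in> borel_measurable M" using int(2) by simp
  have "P.P.indep_var (PiM {1..m} (\<lambda>_. M)) (\<lambda>\<omega>. restrict (\<lambda>i. \<omega> i) {1..m})
          (PiM {Suc m} (\<lambda>_. M)) (\<lambda>\<omega>. restrict (\<lambda>i. \<omega> i) {Suc m})"
    by (rule P.P.indep_var_restrict[OF indep_vars_PiM_coordinates]) auto
  moreover have "(\<lambda>\<omega>. H (\<omega> (Suc m))) \<in> borel_measurable (PiM {Suc m} (\<lambda>_. M))"
    using H by measurable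
  ultimately have "P.P.indep_var borel (F \<circ> (\<lambda>\<omega>. restrict (\<lambda>i. \<omega> i) {1..m}))
      borel ((\<lambda>\<omega>. H (\<omega> (Suc m))) \<circ> (\<lambda>\<omega>. restrict (\<lambda>i. \<omega> i) {Suc m}))"
    using F(1) by (intro P.P.indep_var_compose)
  then have ind: "P.P.indep_var borel F borel (\<lambda>\<omega>. H (\<omega> (Suc m)))"
    by (simp add: comp_def F(2) del: One_nat_def)
  have comp: "distr ?PP M (\<lambda>\<omega>. \<omega> (Suc m)) = M" by (rule P.PiM_component) simp
  have coord: "(\<lambda>\<omega>. \<omega> (Suc m)) \<in> measurable ?PP M" by (rule measurable_component_singleton) simp
  have intH: "integrable ?PP (\<lambda>\<omega>. H (\<omega> (Suc m)))"
    by (rule integrable_distr[OF coord]) (subst comp, rule int(2))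
  show ?int by (rule P.P.indep_var_integrable[OF ind int(1) intH])
  have "(\<integral>\<omega>. F \<omega> * H (\<omega> (Suc m)) \<partial>?PP) = (\<integral>\<omega>. F \<omega> \<partial>?PP) * (\<integral>\<omega>. H (\<omega> (Suc m)) \<partial>?PP)"
    by (rule P.P.indep_var_lebesgue_integral[OF ind int(1) intH])
  also have "(\<integral>\<omega>. H (\<omega> (Suc m)) \<partial>?PP) = expectation H"
    unfolding integral_distr[OF coord H, symmetric] by (subst comp) (rule refl)
  finally show ?zero using zero by simp
qed

section \<open>The process \<open>theta\<close> and its noise\<close>

context RRDO
begin

text \<open>Indices start at 0 here, so \<open>T n\<close> is \<open>\<theta>\<^sub>n\<^sub>+\<^sub>1\<close>.\<close>

abbreviation T where "T n \<omega> \<equiv> theta M \<psi>S \<omega> (Suc n)"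

abbreviation PP where "PP \<equiv> PiM {1::nat..} (\<lambda>_. p)"

text \<open>A martingale difference: given the first \<open>n + 1\<close> coordinates,
  \<open>T (Suc n)\<close> has conditional mean \<open>cadjoint EM *v T n\<close>.\<close>

definition noise where "noise n \<omega> = T (Suc n) \<omega> - cadjoint EM *v T n \<omega>"

lemma T_0: "T 0 \<omega> = psi \<psi>S (M (\<omega> 1))"
  by (simp add: theta_def)

lemma T_Suc: "T (Suc n) \<omega> = cadjoint (M (\<omega> (Suc (Suc n)))) *v T n \<omega>"
  by (simp add: theta_def numeral_2_eq_2)

text \<open>The index set stays open because both the infinite product and the finite block carrying
  the past are needed.\<close>

lemma T_measurable: "{1..Suc n} \<subseteq> I \<Longrightarrow> T n \<in> borel_measurable (PiM I (\<lambda>_. p))"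
proof (induction n)
  case 0
  have "(\<lambda>\<omega>. \<omega> 1) \<in> measurable (PiM I (\<lambda>_. p)) p"
    using 0 by (intro measurable_component_singleton) auto
  from measurable_compose[OF this measurable_psi] show ?case by (simp only: T_0)
next
  case (Suc n)
  have "(\<lambda>\<omega>. \<omega> (Suc (Suc n))) \<in> measurable (PiM I (\<lambda>_. p)) p"
    using Suc.prems by (intro measurable_component_singleton) auto
  then have "(\<lambda>\<omega>. M (\<omega> (Suc (Suc n)))) \<in> borel_measurable (PiM I (\<lambda>_. p))"
    by (rule measurable_compose[OF _ measurable_M])
  moreover have "T n \<in> borel_measurable (PiM I (\<lambda>_. p))"
    using Suc.prems by (intro Suc.IH) auto
  ultimately show ?case unfolding T_Suc
    by (rule borel_measurable_continuous_Pair) (intro continuous_intros)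
qed

lemma noise_measurable: "{1..Suc (Suc n)} \<subseteq> I \<Longrightarrow> noise n \<in> borel_measurable (PiM I (\<lambda>_. p))"
  unfolding noise_def
  by (intro borel_measurable_diff T_measurable borel_measurable_continuous_on[OF _ T_measurable] continuous_intros) auto

lemma T_restrict: "Suc n \<le> m \<Longrightarrow> T n (restrict \<omega> {1..m}) = T n \<omega>"
  by (induction n) (simp_all add: T_0 T_Suc)

lemma PP_component: "\<omega> \<in> space PP \<Longrightarrow> \<omega> (Suc n) \<in> space p"
  by (auto simp: space_PiM)

text \<open>The newest adjoint moves to the argument \<open>v\<close>, where contraction applies;
  hence the induction over all \<open>v\<close>.\<close>

lemma T_functional_bound:
  assumes K: "\<And>\<omega> v. \<omega> \<in> space p \<Longrightarrow> cmod (cinner (psi \<psi>S (M \<omega>)) v) \<le> K * N v" "K \<ge> 0"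
    and \<omega>: "\<omega> \<in> space PP"
  shows "cmod (cinner (T n \<omega>) v) \<le> K * N v"
proof (induction n arbitrary: v)
  case 0
  then show ?case using K(1)[OF PP_component[OF \<omega>, of 0]] by (simp add: T_0)
next
  case (Suc n)
  have "cmod (cinner (T (Suc n) \<omega>) v) \<le> K * N (M (\<omega> (Suc (Suc n))) *v v)"
    unfolding T_Suc cinner_cadjoint by (rule Suc)
  also have "\<dots> \<le> K * N v"
    using contraction[OF PP_component[OF \<omega>]] K(2) by (intro mult_left_mono)
  finally show ?case .
qed

lemma T_bounded: obtains B where "\<And>n \<omega>. \<omega> \<in> space PP \<Longrightarrow> norm (T n \<omega>) \<le> B"
proof -
  obtain K where K: "K \<ge> 0" "\<And>\<omega> v. \<omega> \<in> space p \<Longrightarrow> cmod (cinner (psi \<psi>S (M \<omega>)) v) \<le> K * N v"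
    using psi_bounded by blast
  show thesis
    by (rule that, rule norm_le_of_functional_bound[OF K(1)], rule T_functional_bound[OF K(2,1)])
qed

lemma noise_bounded: obtains B where "\<And>n \<omega>. \<omega> \<in> space PP \<Longrightarrow> norm (noise n \<omega>) \<le> B"
proof -
  obtain B where B: "\<And>n \<omega>. \<omega> \<in> space PP \<Longrightarrow> norm (T n \<omega>) \<le> B" using T_bounded by blast
  have "bounded_linear (\<lambda>v. cadjoint EM *v v)"
    by (rule matrix_vector_mul_bounded_linear)
  then obtain L where L: "L > 0" "\<And>v. norm (cadjoint EM *v v) \<le> norm v * L"
    using bounded_linear.pos_bounded by blast
  show thesis
  proof
    fix n \<omega> assume \<omega>: "\<omega> \<in> space PP"
    have "norm (noise n \<omega>) \<le> norm (T (Suc n) \<omega>) + norm (cadjoint EM *v T n \<omega>)"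
      unfolding noise_def by (rule norm_triangle_ineq4)
    also have "\<dots> \<le> B + B * L"
      using B[OF \<omega>] L(1) by (intro add_mono order_trans[OF L(2)] mult_right_mono) auto
    finally show "norm (noise n \<omega>) \<le> B + B * L" .
  qed
qed

text \<open>Every \<open>M \<omega>\<close> fixes \<open>\<psi>S\<close>, so this component is
  conserved along the process.\<close>

lemma T_\<psi>S: "\<omega> \<in> space PP \<Longrightarrow> cinner \<psi>S (T n \<omega>) = 1"
proof -
  assume \<omega>: "\<omega> \<in> space PP"
  have "cinner (T n \<omega>) \<psi>S = 1"
  proof (induction n)
    case 0
    show ?case unfolding T_0
      using PP_component[OF \<omega>, of 0] by (intro cinner_psi_fixed contractive_M invariant normalized) simp_all
  next
    case (Suc n)
    then show ?case unfolding T_Suc cinner_cadjoint invariant[OF PP_component[OF \<omega>]] .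
  qed
  then show ?thesis by (subst cinner_commute) simp
qed

text \<open>\<open>noise j\<close> is the adjoint of \<open>M (\<omega> (Suc (Suc j))) - EM\<close>
  applied to \<open>T j\<close>. As \<open>i < j\<close>, \<open>noise i\<close> and
  \<open>T j\<close> involve only coordinates up to \<open>Suc j\<close>. Entry by entry the product
  is a past factor \<open>F\<close> times a centred fresh factor \<open>H\<close>.\<close>

lemma noise_orthogonal:
  assumes "i < j"
  shows "(\<integral>\<omega>. noise i \<omega> \<bullet> noise j \<omega> \<partial>PP) = 0"
proof -
  interpret P: prob_space PP by (rule prob_space_PiM) (rule prob_space_axioms)
  obtain B where B: "\<And>n \<omega>. \<omega> \<in> space PP \<Longrightarrow> norm (T n \<omega>) \<le> B" using T_bounded by blast
  obtain B' where B': "\<And>n \<omega>. \<omega> \<in> space PP \<Longrightarrow> norm (noise n \<omega>) \<le> B'" using noise_bounded by blast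
  define F where "F a b \<omega> = cnj (noise i \<omega> $ a) * T j \<omega> $ b" for a b \<omega>
  define H where "H a b \<omega> = cnj (M \<omega> $ b $ a - EM $ b $ a)" for a b \<omega>
  have Fm: "F a b \<in> borel_measurable (PiM I (\<lambda>_. p))" if "{1..Suc j} \<subseteq> I" for a b I
  proof -
    have "noise i \<in> borel_measurable (PiM I (\<lambda>_. p))" "T j \<in> borel_measurable (PiM I (\<lambda>_. p))"
      using that \<open>i < j\<close> by (auto intro!: noise_measurable T_measurable)
    then show ?thesis unfolding F_def
      by (rule borel_measurable_continuous_Pair) (intro continuous_intros)
  qed
  have Fi: "integrable PP (F a b)" for a b
  proof (rule P.integrable_const_bound[of _ "B' * B"])
    show "AE \<omega> in PP. norm (F a b \<omega>) \<le> B' * B"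
    proof (rule AE_I2)
      fix \<omega> assume \<omega>: "\<omega> \<in> space PP"
      have "cmod (noise i \<omega> $ a) \<le> B'" "cmod (T j \<omega> $ b) \<le> B"
        using B[OF \<omega>] B'[OF \<omega>] Finite_Cartesian_Product.norm_nth_le order_trans by blast+
      then show "norm (F a b \<omega>) \<le> B' * B"
        unfolding F_def norm_mult complex_mod_cnj
        by (intro mult_mono) (use order_trans[OF norm_ge_zero] in blast)+
    qed
  qed (rule Fm, auto)
  have entry: "integrable p (\<lambda>\<omega>. M \<omega> $ b $ a)" "(\<integral>\<omega>. M \<omega> $ b $ a \<partial>p) = EM $ b $ a" for a b
  proof -
    have "bounded_linear (\<lambda>A :: complex^'n^'n. A $ b $ a)"
      by (intro bounded_linear_compose[OF bounded_linear_vec_nth bounded_linear_vec_nth])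
    from integrable_bounded_linear[OF this integrable_M] integral_bounded_linear[OF this integrable_M]
    show "integrable p (\<lambda>\<omega>. M \<omega> $ b $ a)" "(\<integral>\<omega>. M \<omega> $ b $ a \<partial>p) = EM $ b $ a"
      by (simp_all add: EM_def)
  qed
  have Hi: "integrable p (H a b)" "expectation (H a b) = 0" for a b
    using entry[of b a] unfolding H_def by (simp_all add: prob_space)
  have restr: "F a b (restrict \<omega> {1..Suc j}) = F a b \<omega>" for a b \<omega>
    using \<open>i < j\<close> by (simp add: F_def noise_def T_restrict del: One_nat_def)
  note FH = PiM_integral_mult_fresh_coordinate[OF Fm[OF order_refl] restr Fi Hi]
  have "noise i \<omega> \<bullet> noise j \<omega> = Re (\<Sum>a\<in>UNIV. \<Sum>b\<in>UNIV. F a b \<omega> * H a b (\<omega> (Suc (Suc j))))" for \<omega>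
    by (simp add: inner_eq_Re_cinner noise_def[of j] T_Suc cinner_def F_def H_def sum_distrib_left
        matrix_vector_mult_def cadjoint_def algebra_simps sum_subtractf)
  then have "(\<integral>\<omega>. noise i \<omega> \<bullet> noise j \<omega> \<partial>PP) =
      (\<integral>\<omega>. Re (\<Sum>a\<in>UNIV. \<Sum>b\<in>UNIV. F a b \<omega> * H a b (\<omega> (Suc (Suc j)))) \<partial>PP)"
    by (simp only:)
  also have "\<dots> = Re (\<integral>\<omega>. (\<Sum>a\<in>UNIV. \<Sum>b\<in>UNIV. F a b \<omega> * H a b (\<omega> (Suc (Suc j)))) \<partial>PP)"
    by (intro integral_Re Bochner_Integration.integrable_sum FH(1))
  also have "(\<integral>\<omega>. (\<Sum>a\<in>UNIV. \<Sum>b\<in>UNIV. F a b \<omega> * H a b (\<omega> (Suc (Suc j)))) \<partial>PP) = 0"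
    by (subst Bochner_Integration.integral_sum Bochner_Integration.integral_sum[OF FH(1)],
        intro Bochner_Integration.integrable_sum FH(1))+ (simp only: FH(2) sum.neutral_const)
  finally show ?thesis by simp
qed

lemma noise_average: "AE \<omega> in PP. (\<lambda>K. (1 / real K) *\<^sub>R (\<Sum>n<K. noise n \<omega>)) \<longlonglongrightarrow> 0"
proof -
  interpret P: prob_space PP by (rule prob_space_PiM) (rule prob_space_axioms)
  obtain B where "\<And>n \<omega>. \<omega> \<in> space PP \<Longrightarrow> norm (noise n \<omega>) \<le> B" using noise_bounded by blast
  then show ?thesis
    by (intro P.bounded_orthogonal_strong_law noise_measurable noise_orthogonal) auto
qed

end

section \<open>Identification of the limit of the averages\<close>

context ergodic_RRDO
begin

lemma theta_average_limit:
  assumes \<omega>: "\<omega> \<in> space PP" and noise: "(\<lambda>K. (1 / real K) *\<^sub>R (\<Sum>n<K. noise n \<omega>)) \<longlonglongrightarrow> 0"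
  shows "(\<lambda>K. (1 / real K) *\<^sub>R (\<Sum>n=1..K. theta M \<psi>S \<omega> n)) \<longlonglongrightarrow> psi \<psi>S EM"
proof -
  obtain B where B: "\<And>n. norm (T n \<omega>) \<le> B" using T_bounded \<omega> by metis
  define S where "S K = (\<Sum>n<K. T n \<omega>)" for K
  define avg where "avg K = (1 / real K) *\<^sub>R S K" for K
  have "S K - cadjoint EM *v S K = (T 0 \<omega> - T K \<omega>) + (\<Sum>n<K. noise n \<omega>)" for K
  proof (induction K)
    case (Suc K)
    have "S (Suc K) - cadjoint EM *v S (Suc K) = (S K - cadjoint EM *v S K) + (T K \<omega> - cadjoint EM *v T K \<omega>)"
      by (simp add: S_def matrix_vector_right_distrib)
    then show ?case by (simp only: Suc) (simp add: noise_def)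
  qed (simp add: S_def)
  moreover have "cinner \<psi>S (S K) = of_nat K" for K
    by (induction K) (simp_all add: S_def cinner_add_right T_\<psi>S[OF \<omega>])
  \<comment> \<open>Each \<open>T n\<close> has component 1 along \<open>\<psi>S\<close>, so the
    rank-one term contributes exactly \<open>K\<close> copies of \<open>Epsi\<close>.\<close>
  ultimately have RS: "one_minus_EMQ_adjoint *v S K = (T 0 \<omega> - T K \<omega>) + (\<Sum>n<K. noise n \<omega>) + of_nat K *s Epsi" for K
    by (simp add: one_minus_EMQ_adjoint_vector_mult)
  have Ravg: "one_minus_EMQ_adjoint *v avg K = (1 / real K) *\<^sub>R (T 0 \<omega> - T K \<omega>) + (1 / real K) *\<^sub>R (\<Sum>n<K. noise n \<omega>) + Epsi"
    if "K > 0" for K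
  proof -
    have "one_minus_EMQ_adjoint *v avg K = (1 / real K) *\<^sub>R (one_minus_EMQ_adjoint *v S K)"
      by (simp add: avg_def scaleR_eq_vector_smult matrix_vector_mult_smult)
    also have "\<dots> = (1 / real K) *\<^sub>R (T 0 \<omega> - T K \<omega>) + (1 / real K) *\<^sub>R (\<Sum>n<K. noise n \<omega>) + (1 / real K) *\<^sub>R (of_nat K *s Epsi)"
      unfolding RS by (simp add: scaleR_add_right)
    also have "(1 / real K) *\<^sub>R (of_nat K *s Epsi) = Epsi"
      using that by (simp add: scaleR_eq_vector_smult)
    finally show ?thesis .
  qed
  have "(\<lambda>K. (1 / real K) *\<^sub>R (T 0 \<omega> - T K \<omega>)) \<longlonglongrightarrow> 0"
  proof (rule Lim_null_comparison[OF _ lim_const_over_n[of "B + B"]])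
    have "norm (T 0 \<omega> - T K \<omega>) \<le> B + B" for K
      using B by (intro order_trans[OF norm_triangle_ineq4] add_mono)
    then show "\<forall>\<^sub>F K in sequentially. norm ((1 / real K) *\<^sub>R (T 0 \<omega> - T K \<omega>)) \<le> (B + B) / real K"
      by (intro always_eventually allI) (simp add: divide_right_mono)
  qed
  then have "(\<lambda>K. (1 / real K) *\<^sub>R (T 0 \<omega> - T K \<omega>) + (1 / real K) *\<^sub>R (\<Sum>n<K. noise n \<omega>) + Epsi) \<longlonglongrightarrow> 0 + 0 + Epsi"
    using noise by (intro tendsto_add tendsto_const)
  moreover have "\<forall>\<^sub>F K in sequentially. (1 / real K) *\<^sub>R (T 0 \<omega> - T K \<omega>) + (1 / real K) *\<^sub>R (\<Sum>n<K. noise n \<omega>) + Epsi = one_minus_EMQ_adjoint *v avg K"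
    using Ravg by (intro eventually_mono[OF eventually_gt_at_top[of 0]]) simp
  ultimately have "(\<lambda>K. one_minus_EMQ_adjoint *v avg K) \<longlonglongrightarrow> Epsi"
    using Lim_transform_eventually by fastforce
  then have "(\<lambda>K. matrix_inv one_minus_EMQ_adjoint *v (one_minus_EMQ_adjoint *v avg K)) \<longlonglongrightarrow> matrix_inv one_minus_EMQ_adjoint *v Epsi"
    by (intro tendsto_matrix_vector_mult tendsto_const)
  then have "avg \<longlonglongrightarrow> matrix_inv one_minus_EMQ_adjoint *v (one_minus_EMQ_adjoint *v psi \<psi>S EM)"
    by (simp only: matrix_inv_vector_mult(2)[OF one_minus_EMQ_adjoint_invertible] one_minus_EMQ_adjoint_psi)
  then have "avg \<longlonglongrightarrow> psi \<psi>S EM"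
    by (simp only: matrix_inv_vector_mult(2)[OF one_minus_EMQ_adjoint_invertible])
  moreover have "avg = (\<lambda>K. (1 / real K) *\<^sub>R (\<Sum>n=1..K. theta M \<psi>S \<omega> n))"
    unfolding avg_def S_def by (simp add: sum.atLeast1_atMost_eq)
  ultimately show ?thesis by (simp only:)
qed

lemma theta_average_AE:
  "\<exists>\<Omega>2\<in>sets PP. measure PP \<Omega>2 = 1 \<and>
     (\<forall>\<omega>\<in>\<Omega>2. (\<lambda>K. (1 / real K) *\<^sub>R (\<Sum>n=1..K. theta M \<psi>S \<omega> n)) \<longlonglongrightarrow> psi \<psi>S EM)"
proof -
  interpret P: prob_space PP by (rule prob_space_PiM) (rule prob_space_axioms)
  have "AE \<omega> in PP. (\<lambda>K. (1 / real K) *\<^sub>R (\<Sum>n=1..K. theta M \<psi>S \<omega> n)) \<longlonglongrightarrow> psi \<psi>S EM"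
    using noise_average by (rule AE_mp) (intro AE_I2 impI theta_average_limit)
  then obtain Z where Z: "{\<omega> \<in> space PP. \<not> (\<lambda>K. (1 / real K) *\<^sub>R (\<Sum>n=1..K. theta M \<psi>S \<omega> n)) \<longlonglongrightarrow> psi \<psi>S EM} \<subseteq> Z"
      "emeasure PP Z = 0" "Z \<in> sets PP"
    by (rule AE_E)
  have "measure PP Z = 0" using Z(2) by (simp add: measure_def)
  then have "measure PP (space PP - Z) = 1" using P.prob_compl[OF Z(3)] by simp
  with Z show ?thesis by (intro bexI[of _ "space PP - Z"]) auto
qed

end

text \<open>Since \<open>matrix_inv\<close> is a total function, invertibility is a conjunct of its
  own: it makes the formula for \<theta> refer to a genuine inverse.\<close>

theorem theorem2:
  fixes p :: "'w measure"
    and M :: "'w \<Rightarrow> complex^'n^'n"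
    and N :: "complex^'n \<Rightarrow> real"
    and \<psi>S :: "complex^'n"
  assumes "RRDO p M N \<psi>S"
    and "measure p {\<omega> \<in> space p. M \<omega> \<in> M_E N \<psi>S} > 0"
  shows "let EM = (\<integral>\<omega>. M \<omega> \<partial>p);
             EMQ = (\<integral>\<omega>. M_Q \<psi>S (M \<omega>) \<partial>p);
             Epsi = (\<integral>\<omega>. psi \<psi>S (M \<omega>) \<partial>p);
             P1 = riesz_projection EM 1;
             \<theta> = matrix_inv (mat 1 - cadjoint EMQ) *v Epsi;
             PP = (\<Pi>\<^sub>M j\<in>{1::nat..}. p)
         in EM \<in> M_E N \<psi>S \<and>
            invertible (mat 1 - cadjoint EMQ) \<and>
            \<theta> = cadjoint P1 *v Epsi \<and>
            cadjoint P1 *v Epsi = cadjoint P1 *v \<psi>S \<and>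
            (\<exists>\<Omega>2\<in>sets PP. measure PP \<Omega>2 = 1 \<and>
               (\<forall>\<omega>\<in>\<Omega>2. (\<lambda>K. (1 / real K) *\<^sub>R (\<Sum>n=1..K. theta M \<psi>S \<omega> n)) \<longlonglongrightarrow> \<theta>))"
proof -
  interpret ergodic_RRDO p M N \<psi>S
    using assms by (simp add: ergodic_RRDO_def ergodic_RRDO_axioms_def)
  have \<theta>: "matrix_inv one_minus_EMQ_adjoint *v Epsi = psi \<psi>S EM"
    using matrix_inv_vector_mult(2)[OF one_minus_EMQ_adjoint_invertible, of "psi \<psi>S EM"] by (simp only: one_minus_EMQ_adjoint_psi)
  have "cinner \<psi>S Epsi = 1" by (subst cinner_commute) (simp add: cinner_Epsi)
  then have "cadjoint (riesz_projection EM 1) *v Epsi = psi \<psi>S EM"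
    by (rule cadjoint_EM_projection)
  moreover have "cadjoint (riesz_projection EM 1) *v \<psi>S = psi \<psi>S EM"
    by (rule cadjoint_EM_projection) (simp add: cinner_self normalized)
  ultimately show ?thesis
    using EM_in_M_E one_minus_EMQ_adjoint_invertible \<theta> theta_average_AE
    unfolding Let_def EM_Q_eq EM_def[symmetric] Epsi_def[symmetric] one_minus_EMQ_adjoint_def[symmetric] by simp
qed

end
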